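(* Let $(Y_n)_n$ be a sequence of real-valued random variables converging in distribution to a random variable $Y$. In addition, let $N$ be a simple point process on $\mathbb{R}$ independent of $Y$, and let $(N_n)_n$ be a sequence of point processes on $\mathbb{R}$ (for each $n$, $Y_n$ and $N_n$ being defined on a common probability space). Let $\mathcal{J}$ be the set of intervals in $\mathbb{R}$ and $\mathcal{U}$ the set of finite unions of intervals in $\mathbb{R}$. If the following two conditions hold: (K1) $\limsup_{n\to\infty}\mathbb{E}[N_n(I)]\le\mathbb{E}[N(I)]$ for every $I\in\mathcal{J}$, (K2) $\lim_{n\to\infty}\mathbb{P}(Y_n\le y,\,N_n(U)=0)=\mathbb{P}(Y\le y)\,\mathbb{P}(N(U)=0)$ for every $y\in\mathbb{R}$ and $U\in\mathcal{U}$, then $N_n$ converges in distribution to $N$, and $(N_n)_n$ and $(Y_n)_n$ are asymptotically independent.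
   Context: A point process on $\mathbb{R}$ is a random locally finite, integer-valued measure on $\mathbb{R}$; it is simple if almost surely all its atoms have mass one. Convergence in distribution of point processes is the usual weak convergence of point processes. Asymptotic independence: let $(Y_n)$ be real random variables converging in distribution to $Y$ and $(N_n)$ point processes on $\mathbb{R}$ converging in distribution to a point process $N$. With $\mathcal{B}_N:=\{B \text{ bounded Borel set}: N(\partial B)=0\text{ a.s.}\}$, where $\partial B$ is the boundary of $B$, the sequences $(Y_n)$ and $(N_n)$ are called asymptotically independent if and only if for every $y\in\mathbb{R}$, every $k\ge1$, $B_1,\ldots,B_k\in\mathcal{B}_N$ and $l_1,\ldots,l_k\in\mathbb{N}_0=\{0,1,2,\ldots\}$, $$\lim_{n\to\infty}\mathbb{P}(Y_n\le y,N_n(B_1)\le l_1,\ldots,N_n(B_k)\le l_k)=\mathbb{P}(Y\le y)\,\mathbb{P}(N(B_1)\le l_1,\ldots,N(B_k)\le l_k).$$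
   Formalization: The formal theorem additionally assumes E[N(I)] < ∞ for every bounded interval I; without it the claim fails, e.g. N = K iid uniform points on [0,1] with E[K] = ∞, N_n = 2N, Y_n = Y = 0. *)

theory Defs
  imports "HOL-Probability.Probability"
begin

section \<open>Point processes on the real line\<close>

text \<open>Locally finite measures on the Borel sets of the reals with values in
  \<open>{0, 1, 2, \<dots>, \<infinity>}\<close>; local finiteness makes bounded sets have finite mass.\<close>

definition pt_measures :: "real measure set" where
  "pt_measures = {\<mu>. sets \<mu> = sets borel \<and>
     (\<forall>B\<in>sets borel. emeasure \<mu> B \<in> range ennreal_of_enat) \<and>
     (\<forall>B\<in>sets borel. bounded B \<longrightarrow> emeasure \<mu> B < \<infinity>)}"

text \<open>The \<open>\<sigma>\<close>-algebra generated by the evaluations \<open>\<mu> \<mapsto> \<mu>(B)\<close>, built in the same way as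
  \<^const>\<open>subprob_algebra\<close>.\<close>

definition pt_algebra :: "real measure measure" where
  "pt_algebra = (SUP B\<in>sets borel. vimage_algebra pt_measures (\<lambda>\<mu>. emeasure \<mu> B) borel)"

definition point_process :: "'a measure \<Rightarrow> ('a \<Rightarrow> real measure) \<Rightarrow> bool" where
  "point_process M N \<longleftrightarrow> prob_space M \<and> N \<in> measurable M pt_algebra"

definition simple_point_process :: "'a measure \<Rightarrow> ('a \<Rightarrow> real measure) \<Rightarrow> bool" where
  "simple_point_process M N \<longleftrightarrow> point_process M N \<and>
     (AE \<omega> in M. \<forall>x. emeasure (N \<omega>) {x} \<noteq> 0 \<longrightarrow> emeasure (N \<omega>) {x} = 1)"

text \<open>\<open>E[N(B)]\<close>, with values in \<open>[0, \<infinity>]\<close>.\<close>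

definition intensity :: "'a measure \<Rightarrow> ('a \<Rightarrow> real measure) \<Rightarrow> real set \<Rightarrow> ennreal" where
  "intensity M N B = (\<integral>\<^sup>+ \<omega>. emeasure (N \<omega>) B \<partial>M)"

text \<open>A bound \<open>limsup E[N\<^sub>n(I)] \<le> E[N(I)]\<close> says nothing when the right-hand side is infinite, so
  limit theorems based on it need \<open>E[N(I)]\<close> finite for bounded intervals. For instance, let \<open>N\<close>
  consist of \<open>K\<close> independent uniform points on \<open>[0, 1]\<close>, where \<open>K\<close> is independent of them and
  \<open>E[K] = \<infinity>\<close>, and let every \<open>N\<^sub>n\<close> be \<open>2 N\<close>: the expectations \<open>E[N\<^sub>n(I)]\<close> and \<open>E[N(I)]\<close> agree on all
  intervals (both are \<open>0\<close> or \<open>\<infinity>\<close>), and so do all avoidance probabilities, but \<open>N\<^sub>n\<close> does not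
  converge to \<open>N\<close>.\<close>

definition locally_finite_intensity :: "'a measure \<Rightarrow> ('a \<Rightarrow> real measure) \<Rightarrow> bool" where
  "locally_finite_intensity M N \<longleftrightarrow>
     (\<forall>I. is_interval I \<and> bounded I \<longrightarrow> intensity M N I < \<infinity>)"


section \<open>Convergence in distribution of point processes\<close>

text \<open>The vague topology: the coarsest topology on \<^const>\<open>pt_measures\<close> making
  \<open>\<mu> \<mapsto> \<integral> f d\<mu>\<close> continuous for every continuous \<open>f\<close> with compact support.\<close>

definition vague_topology :: "real measure topology" where
  "vague_topology = topology_generated_by
     {{\<mu> \<in> pt_measures. (\<integral>x. f x \<partial>\<mu>) \<in> V} | (f :: real \<Rightarrow> real) V.
        continuous_on UNIV f \<and> compact (closure {x. f x \<noteq> 0}) \<and> open V}"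

text \<open>Weak convergence of the laws on the space of point measures with the vague topology. The
  processes may live on different probability spaces. The Bochner integrals are meaningful because
  the Borel sets of the vague topology are exactly the sets of \<^const>\<open>pt_algebra\<close>.\<close>

definition pp_converges_in_distribution ::
  "(nat \<Rightarrow> 'a measure) \<Rightarrow> (nat \<Rightarrow> 'a \<Rightarrow> real measure) \<Rightarrow> 'b measure \<Rightarrow> ('b \<Rightarrow> real measure) \<Rightarrow> bool"
where
  "pp_converges_in_distribution Mn Nn M N \<longleftrightarrow>
     (\<forall>F :: real measure \<Rightarrow> real.
        continuous_map vague_topology euclideanreal F \<and> bounded (F ` pt_measures) \<longrightarrow>
        (\<lambda>n. \<integral>\<omega>. F (Nn n \<omega>) \<partial>Mn n) \<longlonglongrightarrow> (\<integral>\<omega>. F (N \<omega>) \<partial>M))"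


section \<open>Asymptotic independence\<close>

definition continuity_sets :: "'a measure \<Rightarrow> ('a \<Rightarrow> real measure) \<Rightarrow> real set set" where
  "continuity_sets M N =
     {B \<in> sets borel. bounded B \<and> (AE \<omega> in M. emeasure (N \<omega>) (frontier B) = 0)}"

definition asymptotically_independent ::
  "(nat \<Rightarrow> 'a measure) \<Rightarrow> (nat \<Rightarrow> 'a \<Rightarrow> real) \<Rightarrow> (nat \<Rightarrow> 'a \<Rightarrow> real measure) \<Rightarrow>
   'b measure \<Rightarrow> ('b \<Rightarrow> real) \<Rightarrow> ('b \<Rightarrow> real measure) \<Rightarrow> bool"
where
  "asymptotically_independent Mn Yn Nn M Y N \<longleftrightarrow>
     (\<forall>y. \<forall>k\<ge>1. \<forall>B :: nat \<Rightarrow> real set. \<forall>l :: nat \<Rightarrow> nat.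
        (\<forall>i\<in>{1..k}. B i \<in> continuity_sets M N) \<longrightarrow>
        (\<lambda>n. \<P>(\<omega> in Mn n. Yn n \<omega> \<le> y \<and> (\<forall>i\<in>{1..k}. emeasure (Nn n \<omega>) (B i) \<le> of_nat (l i))))
          \<longlonglongrightarrow> \<P>(\<omega> in M. Y \<omega> \<le> y) *
             \<P>(\<omega> in M. \<forall>i\<in>{1..k}. emeasure (N \<omega>) (B i) \<le> of_nat (l i)))"


section \<open>Independence and finite unions of intervals\<close>

text \<open>Independence of the generated \<open>\<sigma>\<close>-algebras; \<^const>\<open>prob_space.indep_var\<close> would force both
  variables to have the same type of values.\<close>

definition independent_of_pp :: "'a measure \<Rightarrow> ('a \<Rightarrow> real) \<Rightarrow> ('a \<Rightarrow> real measure) \<Rightarrow> bool" where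
  "independent_of_pp M Y N \<longleftrightarrow>
     prob_space.indep_set M (sets (vimage_algebra (space M) Y borel))
                            (sets (vimage_algebra (space M) N pt_algebra))"

definition interval_unions :: "real set set" where
  "interval_unions = {\<Union>\<A> | \<A>. finite \<A> \<and> (\<forall>I\<in>\<A>. is_interval I)}"

end

theory Submission
  imports Defs
begin

text \<open>
  Fix a bounded window and cut it into dyadic cells. The events that concern only which cells are
  occupied are determined by avoidance probabilities of finite unions of intervals through
  inclusion-exclusion, so their probabilities converge, jointly with the events \<open>Yn n \<omega> \<le> y\<close>
  (\<open>occupied_pattern_convergence\<close>).

  Occupation of cells determines counts of points as long as no cell contains two points. The
  probability that the window has such a crowded cell is at most the mean number of points minus the
  mean number of occupied cells. For the simple process \<open>N\<close> this difference tends to zero as the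
  cells shrink, by dominated convergence, the intensity being locally finite. For \<open>Nn n\<close> at a
  fixed level, the upper bound on the limit of the intensities and the convergence of the occupation
  probabilities make it asymptotically no larger (\<open>eventually_rarely_crowded\<close>). A bounded Borel set
  \<open>B\<close> is a union of cells up to those cells that meet its boundary, and if \<open>N\<close> does not charge the
  boundary, it is unlikely that these are occupied. Together this yields joint convergence of the
  counts (\<open>count_convergence\<close>). For continuity sets \<open>B\<close> and events \<open>Yn n \<omega> \<le> y\<close> this is asymptotic
  independence.

  The hypotheses speak of all intervals, whether or not \<open>N\<close> has fixed atoms at endpoints, so the
  vectors of cell counts converge in law as well, and they take values in a countable set. This gives
  convergence in distribution for the vague topology, because a vague neighbourhood
  of a measure \<open>\<mu>\<close> contains all measures with the same counts as \<open>\<mu>\<close> in sufficiently fine cells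
  of a sufficiently large window (\<open>eventually_same_cell_counts_in_open\<close>). Hence a
  nonnegative vaguely continuous functional is the
  limit, from below, of functionals of finitely many cell counts, and Fatou's lemma
  gives one half of the convergence of expectations
  (\<open>nn_integral_vague_continuous_le_liminf\<close>); the other half comes from changing the sign.
\<close>

section \<open>Dyadic cells\<close>

definition cell :: "nat \<Rightarrow> int \<Rightarrow> real set" where
  "cell m j = {real_of_int j / 2 ^ m <.. real_of_int (j + 1) / 2 ^ m}"

definition window :: "nat \<Rightarrow> nat \<Rightarrow> int set" where
  "window m R = {- int R * 2 ^ m ..< int R * 2 ^ m}"

lemma finite_window [simp]: "finite (window m R)"
  by (simp add: window_def)

lemma window_mono: "R \<le> R' \<Longrightarrow> window m R \<subseteq> window m R'"
proof -
  assume "R \<le> R'"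
  then have "int R * 2 ^ m \<le> int R' * 2 ^ m" by (intro mult_right_mono) auto
  then show ?thesis by (auto simp: window_def)
qed

lemma cell_borel [measurable, simp]: "cell m j \<in> sets borel"
  by (simp add: cell_def)

lemma is_interval_cell: "is_interval (cell m j)"
  by (simp add: cell_def is_interval_oc)

lemma mem_cell_iff: "x \<in> cell m j \<longleftrightarrow> j = \<lceil>x * 2 ^ m\<rceil> - 1"
proof -
  have "x \<in> cell m j \<longleftrightarrow> real_of_int (j + 1) - 1 < x * 2 ^ m \<and> x * 2 ^ m \<le> real_of_int (j + 1)"
    by (auto simp: cell_def field_simps)
  also have "\<dots> \<longleftrightarrow> \<lceil>x * 2 ^ m\<rceil> = j + 1"
    unfolding ceiling_eq_iff by simp
  finally show ?thesis by auto
qed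

lemma disjoint_cells: "disjoint_family_on (cell m) J"
  by (auto simp: disjoint_family_on_def mem_cell_iff)

lemma dist_cell:
  assumes "x \<in> cell m j" "y \<in> cell m j"
  shows "dist x y \<le> 1 / 2 ^ m"
proof -
  have "real_of_int (j + 1) / 2 ^ m - real_of_int j / 2 ^ m = 1 / 2 ^ m"
    by (simp add: field_simps)
  with assms show ?thesis by (auto simp: cell_def dist_real_def)
qed

lemma Union_cells: "(\<Union>j\<in>window m R. cell m j) = {- real R <.. real R}"
proof -
  have "x \<in> (\<Union>j\<in>window m R. cell m j) \<longleftrightarrow> - real R < x \<and> x \<le> real R" for x
  proof -
    have "x \<in> (\<Union>j\<in>window m R. cell m j) \<longleftrightarrow>
        - int R * 2 ^ m < \<lceil>x * 2 ^ m\<rceil> \<and> \<lceil>x * 2 ^ m\<rceil> \<le> int R * 2 ^ m"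
      by (auto simp: mem_cell_iff window_def)
    also have "\<dots> \<longleftrightarrow> - real R * 2 ^ m < x * 2 ^ m \<and> x * 2 ^ m \<le> real R * 2 ^ m"
      by (simp add: less_ceiling_iff ceiling_le_iff)
    also have "\<dots> \<longleftrightarrow> - real R < x \<and> x \<le> real R"
      using mult_less_cancel_right_pos[of "2 ^ m" "- real R" x] by simp
    finally show ?thesis .
  qed
  then show ?thesis by (intro set_eqI) (simp only: greaterThanAtMost_iff)
qed

lemma bounded_cell: "bounded (cell m j)"
  by (simp add: cell_def)

lemma cell_subset_window: "j \<in> window m R \<Longrightarrow> cell m j \<subseteq> {- real R <.. real R}"
  using Union_cells[of m R] by blast

lemma cell_nonempty: "cell m j \<noteq> {}"
  by (auto simp: cell_def field_simps)

lemma eventually_dyadic_less: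
  assumes "0 < (e::real)"
  shows "eventually (\<lambda>m::nat. 1 / 2 ^ m < e) sequentially"
proof -
  have "(\<lambda>m. (1/2::real) ^ m) \<longlonglongrightarrow> 0" by (rule LIMSEQ_realpow_zero) auto
  from order_tendstoD(2)[OF this assms] show ?thesis by (simp add: power_divide)
qed

section \<open>Counting points of a measure by dyadic cells\<close>

lemma
  assumes "\<mu> \<in> pt_measures"
  shows pt_measures_sets: "sets \<mu> = sets borel"
    and pt_measures_space: "space \<mu> = UNIV"
  using assms sets_eq_imp_space_eq[of \<mu> borel] by (auto simp: pt_measures_def)

lemma pt_measures_count:
  assumes "\<mu> \<in> pt_measures" "B \<in> sets borel" "bounded B"
  obtains k :: nat where "emeasure \<mu> B = of_nat k"
proof -
  obtain e where e: "emeasure \<mu> B = ennreal_of_enat e" and "emeasure \<mu> B < \<infinity>"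
    using assms unfolding pt_measures_def by blast
  then obtain k where "e = enat k" by (cases e) auto
  with e that show ?thesis by simp
qed

lemma emeasure_cell_decomposition:
  assumes "\<mu> \<in> pt_measures" "B \<in> sets borel" "B \<subseteq> {- real R <.. real R}"
  shows "emeasure \<mu> B = (\<Sum>j\<in>window m R. emeasure \<mu> (B \<inter> cell m j))"
proof -
  have "B = (\<Union>j\<in>window m R. B \<inter> cell m j)"
    using assms(3) Union_cells[of m R] by blast
  moreover have "(\<Sum>j\<in>window m R. emeasure \<mu> (B \<inter> cell m j)) =
      emeasure \<mu> (\<Union>j\<in>window m R. B \<inter> cell m j)"
    using assms disjoint_cells[of m "window m R"]
    by (intro sum_emeasure) (auto simp: pt_measures_sets disjoint_family_on_def)
  ultimately show ?thesis by simp
qed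

lemma emeasure_window:
  assumes "\<mu> \<in> pt_measures"
  shows "emeasure \<mu> {- real R <.. real R} = (\<Sum>j\<in>window m R. emeasure \<mu> (cell m j))"
proof -
  have "{- real R <.. real R} \<inter> cell m j = cell m j" if "j \<in> window m R" for j
    using cell_subset_window[OF that] by blast
  then show ?thesis
    using emeasure_cell_decomposition[OF assms, of "{- real R <.. real R}" R m] by simp
qed

definition occupied :: "nat \<Rightarrow> nat \<Rightarrow> real measure \<Rightarrow> int set" where
  "occupied m R \<mu> = {j \<in> window m R. emeasure \<mu> (cell m j) \<noteq> 0}"

definition crowded :: "nat \<Rightarrow> nat \<Rightarrow> real measure \<Rightarrow> bool" where
  "crowded m R \<mu> \<longleftrightarrow> (\<exists>j\<in>window m R. emeasure \<mu> (cell m j) > 1)"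

text \<open>The union of the cells that the boundary of \<open>B\<close> cuts: outside of it, \<open>B\<close> is a union of cells.\<close>

definition straddling :: "nat \<Rightarrow> nat \<Rightarrow> real set \<Rightarrow> real set" where
  "straddling m R B = (\<Union>j\<in>{j \<in> window m R. cell m j \<inter> B \<noteq> {} \<and> cell m j - B \<noteq> {}}. cell m j)"

lemma finite_occupied [simp]: "finite (occupied m R \<mu>)"
  by (simp add: occupied_def)

lemma straddling_borel [measurable, simp]: "straddling m R B \<in> sets borel"
  unfolding straddling_def by (intro sets.finite_UN) auto

text \<open>An integer-valued measure that is at most one on every cell gives a cell mass one exactly when it
  charges the cell. This turns a count into a function of the set of occupied cells, which avoidance
  probabilities can see.\<close>

lemma emeasure_eq_card_occupied:
  assumes \<mu>: "\<mu> \<in> pt_measures" and B: "B \<in> sets borel" "B \<subseteq> {- real R <.. real R}"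
    and ncr: "\<not> crowded m R \<mu>" and str: "emeasure \<mu> (straddling m R B) = 0"
  shows "emeasure \<mu> B = of_nat (card {j \<in> occupied m R \<mu>. cell m j \<subseteq> B})"
proof -
  note [simp] = pt_measures_sets[OF \<mu>]
  have "emeasure \<mu> (B \<inter> cell m j) = (if emeasure \<mu> (cell m j) \<noteq> 0 \<and> cell m j \<subseteq> B then 1 else 0)"
    if j: "j \<in> window m R" for j
  proof -
    obtain k :: nat where k: "emeasure \<mu> (cell m j) = of_nat k"
      using pt_measures_count[OF \<mu> cell_borel bounded_cell] .
    have "of_nat k \<le> (of_nat 1 :: ennreal)"
      using ncr j k by (auto simp: crowded_def not_less)
    then have "k \<le> 1" unfolding of_nat_le_iff .
    consider "cell m j \<subseteq> B" | "cell m j \<inter> B = {}" | "cell m j \<inter> B \<noteq> {}" "cell m j - B \<noteq> {}"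
      by blast
    then show ?thesis
    proof cases
      case 1
      then have "B \<inter> cell m j = cell m j" by blast
      with 1 k \<open>k \<le> 1\<close> show ?thesis by (cases k) auto
    next
      case 2
      with cell_nonempty[of m j] show ?thesis by (auto simp: Int_commute)
    next
      case 3
      then have "cell m j \<subseteq> straddling m R B" using j by (auto simp: straddling_def)
      then have "emeasure \<mu> (B \<inter> cell m j) \<le> emeasure \<mu> (straddling m R B)"
        by (intro emeasure_mono) auto
      with str 3 show ?thesis by auto
    qed
  qed
  then have "emeasure \<mu> B =
      (\<Sum>j\<in>window m R. if emeasure \<mu> (cell m j) \<noteq> 0 \<and> cell m j \<subseteq> B then 1 else 0)"
    using emeasure_cell_decomposition[OF \<mu> B, of m] by simp
  also have "\<dots> = of_nat (card {j \<in> occupied m R \<mu>. cell m j \<subseteq> B})"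
    by (subst sum.inter_filter[symmetric]) (auto simp: occupied_def conj_assoc)
  finally show ?thesis .
qed

text \<open>Every occupied cell contributes at least one point to the window, and a crowded cell at least two.
  Taking expectations bounds the probability of crowding by the gap between the mean number of points
  and the mean number of occupied cells.\<close>

lemma card_occupied_crowded_le:
  assumes \<mu>: "\<mu> \<in> pt_measures"
  shows "of_nat (card (occupied m R \<mu>)) + indicator {\<mu>. crowded m R \<mu>} \<mu>
    \<le> emeasure \<mu> {- real R <.. real R}"
proof -
  define c where "c j = emeasure \<mu> (cell m j)" for j
  have nat: "\<exists>k::nat. c j = of_nat k" for j
  proof -
    obtain k :: nat where "emeasure \<mu> (cell m j) = of_nat k"
      using pt_measures_count[OF \<mu> cell_borel bounded_cell] .
    then show ?thesis unfolding c_def by blast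
  qed
  have ge1: "(if c j \<noteq> 0 then 1 else 0) \<le> c j" for j
  proof -
    obtain k :: nat where "c j = of_nat k" using nat by blast
    then show ?thesis by (cases k) auto
  qed
  have occ: "of_nat (card (occupied m R \<mu>)) = (\<Sum>j\<in>window m R. if c j \<noteq> 0 then 1 else 0 :: ennreal)"
    by (subst sum.inter_filter[symmetric]) (auto simp: occupied_def c_def)
  have tot: "emeasure \<mu> {- real R <.. real R} = (\<Sum>j\<in>window m R. c j)"
    using emeasure_window[OF \<mu>] by (simp add: c_def)
  show ?thesis
  proof (cases "crowded m R \<mu>")
    case False
    then show ?thesis unfolding occ tot by (auto intro!: sum_mono ge1)
  next
    case True
    then obtain i where i: "i \<in> window m R" "1 < c i" by (auto simp: crowded_def c_def)
    obtain k :: nat where k: "c i = of_nat k" using nat by blast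
    with i have "of_nat 1 < (of_nat k :: ennreal)" by simp
    then have "1 < k" unfolding of_nat_less_iff .
    then have "of_nat 2 \<le> (of_nat k :: ennreal)" unfolding of_nat_le_iff by simp
    then have 2: "1 + 1 \<le> c i" unfolding k by simp
    have "(\<Sum>j\<in>window m R. if c j \<noteq> 0 then 1 else 0) + 1
        = (\<Sum>j\<in>window m R - {i}. if c j \<noteq> 0 then 1 else 0) + (1 + 1)"
      using i by (subst sum.remove[of _ i]) (auto simp: ac_simps)
    also have "\<dots> \<le> (\<Sum>j\<in>window m R - {i}. c j) + c i"
      by (intro add_mono sum_mono ge1 2)
    also have "\<dots> = (\<Sum>j\<in>window m R. c j)"
      using i by (subst (2) sum.remove[of _ i]) (auto simp: ac_simps)
    finally show ?thesis using True unfolding occ tot by simp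
  qed
qed

text \<open>Around every point there is a ball of mass less than two, because the masses of shrinking balls
  decrease to the mass of the atom. Cells shorter than a Lebesgue number of this cover of the compact
  window lie in one of these balls, so their mass, an integer, is at most one.\<close>

lemma eventually_not_crowded:
  assumes \<mu>: "\<mu> \<in> pt_measures" and simple: "\<And>x. emeasure \<mu> {x} \<le> 1"
  shows "eventually (\<lambda>m. \<not> crowded m R \<mu>) sequentially"
proof -
  note [simp] = pt_measures_sets[OF \<mu>]
  have "\<exists>d>0. emeasure \<mu> (ball x d) < 2" for x
  proof -
    define A where "A i = cball x (1 / 2 ^ i)" for i :: nat
    have A_borel: "A i \<in> sets borel" for i by (auto simp: A_def)
    have fin: "emeasure \<mu> (A i) \<noteq> \<infinity>" for i
    proof -
      have "A i \<in> sets borel" "bounded (A i)" by (auto simp: A_def)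
      from pt_measures_count[OF \<mu> this] obtain k :: nat where "emeasure \<mu> (A i) = of_nat k" .
      then show ?thesis by simp
    qed
    have "decseq A"
    proof (rule decseq_SucI)
      fix i
      have "1 / 2 ^ Suc i \<le> (1 / 2 ^ i :: real)" by (simp add: field_simps)
      then show "A (Suc i) \<le> A i" by (auto simp: A_def)
    qed
    have "(\<Inter>i. A i) = {x}"
    proof -
      have "y = x" if "\<forall>i. y \<in> A i" for y
      proof (rule ccontr)
        assume "y \<noteq> x"
        then have "0 < dist x y" by simp
        from eventually_dyadic_less[OF this] obtain i where "1 / 2 ^ i < dist x y"
          by (auto simp: eventually_sequentially)
        moreover have "dist x y \<le> 1 / 2 ^ i" using that by (auto simp: A_def)
        ultimately show False by linarith
      qed
      then show ?thesis by (auto simp: A_def)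
    qed
    then have "(\<lambda>i. emeasure \<mu> (A i)) \<longlonglongrightarrow> emeasure \<mu> {x}"
      using Lim_emeasure_decseq[of A \<mu>] fin \<open>decseq A\<close> A_borel by auto
    moreover have "emeasure \<mu> {x} < 2"
      using simple[of x] by (rule le_less_trans) simp
    ultimately have "eventually (\<lambda>i. emeasure \<mu> (A i) < 2) sequentially"
      by (rule order_tendstoD)
    then obtain i where "emeasure \<mu> (A i) < 2" by (auto simp: eventually_sequentially)
    moreover have "emeasure \<mu> (ball x (1 / 2 ^ i)) \<le> emeasure \<mu> (A i)"
      by (intro emeasure_mono) (auto simp: A_def)
    ultimately show ?thesis by (intro exI[of _ "1 / 2 ^ i"]) auto
  qed
  then obtain d where d: "\<And>x. d x > 0" "\<And>x. emeasure \<mu> (ball x (d x)) < 2" by metis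
  have "x \<in> ball x (d x)" for x using d(1) by simp
  then have "{- real R .. real R} \<subseteq> \<Union>(range (\<lambda>x. ball x (d x)))" by blast
  then obtain e where e: "0 < e" "\<And>T. T \<subseteq> {- real R .. real R} \<Longrightarrow> diameter T < e \<Longrightarrow>
      \<exists>B\<in>range (\<lambda>x. ball x (d x)). T \<subseteq> B"
    by (rule Lebesgue_number_lemma[OF compact_Icc, rotated]) blast+
  from eventually_dyadic_less[OF e(1)] show ?thesis
  proof eventually_elim
    case (elim m)
    have "\<not> 1 < emeasure \<mu> (cell m j)" if j: "j \<in> window m R" for j
    proof
      assume "1 < emeasure \<mu> (cell m j)"
      moreover obtain k :: nat where k: "emeasure \<mu> (cell m j) = of_nat k"
        using pt_measures_count[OF \<mu> cell_borel bounded_cell] .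
      ultimately have "of_nat 1 < (of_nat k :: ennreal)" by simp
      then have "of_nat 2 \<le> (of_nat k :: ennreal)"
        unfolding of_nat_less_iff of_nat_le_iff by simp
      moreover have "diameter (cell m j) \<le> 1 / 2 ^ m"
        by (rule diameter_le) (use dist_cell in \<open>auto simp: dist_real_def\<close>)
      then obtain x where "cell m j \<subseteq> ball x (d x)"
      proof -
        have "cell m j \<subseteq> {- real R .. real R}" using cell_subset_window[OF j] by auto
        moreover have "diameter (cell m j) < e"
          using \<open>diameter (cell m j) \<le> 1 / 2 ^ m\<close> elim by linarith
        ultimately show ?thesis using e(2)[of "cell m j"] that by auto
      qed
      then have "emeasure \<mu> (cell m j) \<le> emeasure \<mu> (ball x (d x))"
        by (intro emeasure_mono) auto
      ultimately have "of_nat 2 < (2 :: ennreal)" using d(2)[of x] k by (metis order.strict_trans1)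
      then show False by simp
    qed
    then show ?case by (auto simp: crowded_def)
  qed
qed

text \<open>A cell that meets both \<open>B\<close> and its complement meets the boundary of \<open>B\<close>, since cells are connected.
  So the straddling cells lie in closed neighbourhoods that shrink to the boundary; their masses
  decrease to zero, and being integers they vanish eventually.\<close>

lemma eventually_straddling_null:
  assumes \<mu>: "\<mu> \<in> pt_measures" and B: "bounded B" and null: "emeasure \<mu> (frontier B) = 0"
  shows "eventually (\<lambda>m. emeasure \<mu> (straddling m R B) = 0) sequentially"
proof -
  note [simp] = pt_measures_sets[OF \<mu>]
  have front: "cell m j \<inter> frontier B \<noteq> {}"
    if "cell m j \<inter> B \<noteq> {}" "cell m j - B \<noteq> {}" for m j
    using connected_Int_frontier[OF _ that] is_interval_cell is_interval_connected by blast
  show ?thesis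
  proof (cases "frontier B = {}")
    case True
    then have "straddling m R B = {}" for m
      using front by (auto simp: straddling_def)
    then show ?thesis by simp
  next
    case False
    define A where "A i = {x \<in> {- real R .. real R}. infdist x (frontier B) \<le> 1 / 2 ^ i}" for i :: nat
    have A_eq: "A i = {- real R .. real R} \<inter> {x. infdist x (frontier B) \<le> 1 / 2 ^ i}" for i
      by (auto simp: A_def)
    have "closed (A i)" for i
      unfolding A_eq
      by (intro closed_Int closed_Collect_le continuous_on_infdist continuous_on_id
            continuous_on_const closed_atLeastAtMost)
    then have A_borel: "A i \<in> sets borel" for i by (simp add: borel_closed)
    have A_bdd: "bounded (A i)" for i
      by (rule bounded_subset[of "{- real R .. real R}"]) (auto simp: A_def)
    have fin: "emeasure \<mu> (A i) \<noteq> \<infinity>" for i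
    proof -
      obtain k :: nat where "emeasure \<mu> (A i) = of_nat k"
        using pt_measures_count[OF \<mu> A_borel A_bdd] .
      then show ?thesis by simp
    qed
    have "decseq A"
    proof (rule decseq_SucI)
      fix i
      have "1 / 2 ^ Suc i \<le> (1 / 2 ^ i :: real)" by (simp add: field_simps)
      then show "A (Suc i) \<le> A i" by (auto simp: A_def)
    qed
    have "(\<Inter>i. A i) \<subseteq> frontier B"
    proof
      fix x assume x: "x \<in> (\<Inter>i. A i)"
      have "\<not> 0 < infdist x (frontier B)"
      proof
        assume "0 < infdist x (frontier B)"
        from eventually_dyadic_less[OF this] obtain i where "1 / 2 ^ i < infdist x (frontier B)"
          by (auto simp: eventually_sequentially)
        moreover have "infdist x (frontier B) \<le> 1 / 2 ^ i" using x by (auto simp: A_def)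
        ultimately show False by linarith
      qed
      then have "infdist x (frontier B) = 0" using infdist_nonneg[of x "frontier B"] by linarith
      then show "x \<in> frontier B"
        using in_closed_iff_infdist_zero[OF frontier_closed False] by blast
    qed
    then have "emeasure \<mu> (\<Inter>i. A i) \<le> emeasure \<mu> (frontier B)"
      by (intro emeasure_mono) (auto simp: frontier_closed)
    then have "emeasure \<mu> (\<Inter>i. A i) = 0" using null by simp
    then have "(\<lambda>i. emeasure \<mu> (A i)) \<longlonglongrightarrow> 0"
      using Lim_emeasure_decseq[of A \<mu>] fin \<open>decseq A\<close> A_borel by auto
    then have "eventually (\<lambda>i. emeasure \<mu> (A i) < 1) sequentially"
      by (rule order_tendstoD) simp
    then show ?thesis
    proof eventually_elim
      case (elim m)
      obtain k :: nat where k: "emeasure \<mu> (A m) = of_nat k"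
        using pt_measures_count[OF \<mu> A_borel A_bdd] .
      with elim have "of_nat k < (of_nat 1 :: ennreal)" by simp
      then have "k = 0" unfolding of_nat_less_iff by simp
      have "straddling m R B \<subseteq> A m"
      proof
        fix x assume "x \<in> straddling m R B"
        then obtain j where j: "j \<in> window m R" "x \<in> cell m j"
            "cell m j \<inter> B \<noteq> {}" "cell m j - B \<noteq> {}"
          by (auto simp: straddling_def)
        from front[OF j(3,4)] obtain z where z: "z \<in> cell m j" "z \<in> frontier B" by blast
        have "infdist x (frontier B) \<le> dist x z" using z(2) by (rule infdist_le)
        also have "\<dots> \<le> 1 / 2 ^ m" using j(2) z(1) by (rule dist_cell)
        finally show "x \<in> A m"
          using cell_subset_window[OF j(1)] j(2) by (auto simp: A_def)
      qed
      then have "emeasure \<mu> (straddling m R B) \<le> emeasure \<mu> (A m)"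
        by (intro emeasure_mono) (auto simp: A_borel)
      with k \<open>k = 0\<close> show ?case by simp
    qed
  qed
qed

text \<open>Dyadic partitions are nested: whether a point lies in a coarse cell depends only on the fine cell
  that contains it.\<close>

lemma straddling_cell:
  assumes "k \<le> m"
  shows "straddling m R (cell k j) = {}"
proof -
  define d where "d = m - k"
  have m: "(2::real) ^ m = 2 ^ k * 2 ^ d" using assms by (simp add: d_def flip: power_add)
  have iff: "x \<in> cell k j \<longleftrightarrow> j * 2 ^ d \<le> i \<and> i < (j + 1) * 2 ^ d" if "x \<in> cell m i" for x i
  proof -
    have i: "\<lceil>x * 2 ^ m\<rceil> = i + 1" using that by (simp add: mem_cell_iff)
    have "x \<in> cell k j \<longleftrightarrow> real_of_int j < x * 2 ^ k \<and> x * 2 ^ k \<le> real_of_int (j + 1)"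
      by (auto simp: cell_def field_simps)
    also have "\<dots> \<longleftrightarrow> real_of_int j * 2 ^ d < (x * 2 ^ k) * 2 ^ d \<and> (x * 2 ^ k) * 2 ^ d \<le> real_of_int (j + 1) * 2 ^ d"
      by simp
    also have "\<dots> \<longleftrightarrow> real_of_int (j * 2 ^ d) < x * 2 ^ m \<and> x * 2 ^ m \<le> real_of_int ((j + 1) * 2 ^ d)"
      by (simp add: m ac_simps)
    also have "\<dots> \<longleftrightarrow> j * 2 ^ d < i + 1 \<and> i + 1 \<le> (j + 1) * 2 ^ d"
      by (simp only: less_ceiling_iff[symmetric] ceiling_le_iff[symmetric] i)
    finally show ?thesis by auto
  qed
  then show ?thesis unfolding straddling_def by blast
qed

section \<open>Events of a point process\<close>

lemma point_process_prob_space: "point_process M N \<Longrightarrow> prob_space M"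
  by (simp add: point_process_def)

lemma point_process_in_pt_measures:
  assumes "point_process M N" "\<omega> \<in> space M"
  shows "N \<omega> \<in> pt_measures"
proof -
  have "space pt_algebra = pt_measures"
    by (auto simp: pt_algebra_def space_Sup_eq_UN)
  then show ?thesis using assms measurable_space[of N M pt_algebra] by (auto simp: point_process_def)
qed

lemma measurable_point_count:
  assumes "point_process M N" "B \<in> sets borel"
  shows "(\<lambda>\<omega>. emeasure (N \<omega>) B) \<in> borel_measurable M"
proof -
  have "(\<lambda>\<mu>. emeasure \<mu> B) \<in> borel_measurable pt_algebra"
    using assms(2)
    by (auto intro!: measurable_Sup1 measurable_vimage_algebra1 simp: pt_algebra_def)
  then show ?thesis using assms(1) measurable_compose by (auto simp: point_process_def)
qed

lemma interval_unionsI: "finite J \<Longrightarrow> (\<And>j. j \<in> J \<Longrightarrow> is_interval (I j)) \<Longrightarrow> (\<Union>j\<in>J. I j) \<in> interval_unions"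
  by (auto simp: interval_unions_def intro!: exI[of _ "I ` J"])

lemma interval_in_interval_unions: "is_interval I \<Longrightarrow> I \<in> interval_unions"
  using interval_unionsI[of "{()}" "\<lambda>_. I"] by simp

lemma empty_in_interval_unions: "{} \<in> interval_unions"
  using interval_unionsI[of "{}::unit set" "\<lambda>_. {}"] by simp

lemma interval_unions_Un: "U \<in> interval_unions \<Longrightarrow> V \<in> interval_unions \<Longrightarrow> U \<union> V \<in> interval_unions"
proof -
  assume "U \<in> interval_unions" "V \<in> interval_unions"
  then obtain A B where "finite A" "finite B" "\<forall>I\<in>A. is_interval I" "\<forall>I\<in>B. is_interval I"
      "U = \<Union>A" "V = \<Union>B"
    by (auto simp: interval_unions_def)
  then show ?thesis unfolding interval_unions_def by (intro CollectI exI[of _ "A \<union> B"]) auto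
qed

lemma interval_unions_borel: "U \<in> interval_unions \<Longrightarrow> U \<in> sets borel"
proof -
  assume "U \<in> interval_unions"
  then obtain A where "finite A" "\<forall>I\<in>A. is_interval I" "U = \<Union>A"
    by (auto simp: interval_unions_def)
  then show ?thesis using real_interval_borel_measurable by (intro sets.finite_Union[of A borel, folded \<open>U = \<Union>A\<close>]) auto
qed

lemma straddling_interval_union: "straddling m R B \<in> interval_unions"
  unfolding straddling_def by (intro interval_unionsI is_interval_cell) auto

lemma avoids_Un:
  assumes "\<mu> \<in> pt_measures" "U \<in> sets borel" "V \<in> sets borel"
  shows "emeasure \<mu> (U \<union> V) = 0 \<longleftrightarrow> emeasure \<mu> U = 0 \<and> emeasure \<mu> V = 0"
proof -
  have "U \<in> sets \<mu>" "V \<in> sets \<mu>" using assms by (auto simp: pt_measures_sets)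
  then show ?thesis
    using emeasure_subadditive[of U \<mu> V] emeasure_mono[of U "U \<union> V" \<mu>] emeasure_mono[of V "U \<union> V" \<mu>]
    by auto
qed

lemma avoids_UN:
  assumes "\<mu> \<in> pt_measures" "finite J" "\<And>j. j \<in> J \<Longrightarrow> I j \<in> sets borel"
  shows "emeasure \<mu> (\<Union>j\<in>J. I j) = 0 \<longleftrightarrow> (\<forall>j\<in>J. emeasure \<mu> (I j) = 0)"
  using assms(2,3)
proof (induction J rule: finite_induct)
  case (insert x F)
  then show ?case
    using avoids_Un[OF assms(1), of "I x" "\<Union>j\<in>F. I j"] sets.finite_UN[of F I borel] by simp
qed simp

section \<open>Occupation patterns of finitely many intervals\<close>

text \<open>Being charged is the complement of being avoided, and avoiding two sets is avoiding their union: one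
  step of inclusion-exclusion.\<close>

lemma occupied_pattern_prob_insert:
  assumes pp: "point_process M N" and [measurable]: "Measurable.pred M A"
    and "finite T" and [measurable]: "\<And>j. j \<in> insert i T \<Longrightarrow> I j \<in> sets borel" "U \<in> sets borel"
  shows "\<P>(\<omega> in M. A \<omega> \<and> emeasure (N \<omega>) U = 0 \<and> (\<forall>j\<in>insert i T. emeasure (N \<omega>) (I j) \<noteq> 0)) =
    \<P>(\<omega> in M. A \<omega> \<and> emeasure (N \<omega>) U = 0 \<and> (\<forall>j\<in>T. emeasure (N \<omega>) (I j) \<noteq> 0)) -
    \<P>(\<omega> in M. A \<omega> \<and> emeasure (N \<omega>) (U \<union> I i) = 0 \<and> (\<forall>j\<in>T. emeasure (N \<omega>) (I j) \<noteq> 0))"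
    (is "measure M ?L = measure M ?X - measure M ?Y")
proof -
  interpret prob_space M using pp by (rule point_process_prob_space)
  note [measurable] = measurable_point_count[OF pp] and [simp] = \<open>finite T\<close>
  have "{\<omega> \<in> space M. \<forall>j\<in>T. emeasure (N \<omega>) (I j) \<noteq> 0} \<in> sets M"
    by (intro sets.sets_Collect_finite_All) auto
  then have [measurable]: "Measurable.pred M (\<lambda>\<omega>. \<forall>j\<in>T. emeasure (N \<omega>) (I j) \<noteq> 0)"
    by (simp add: pred_def)
  have "?L = ?X - ?Y"
    using avoids_Un[OF point_process_in_pt_measures[OF pp]] assms(4)[of i] assms(5) by auto
  moreover have "?Y \<subseteq> ?X"
    using avoids_Un[OF point_process_in_pt_measures[OF pp]] assms(4)[of i] assms(5) by auto
  moreover have "?X \<in> sets M" by measurable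
  moreover have "?Y \<in> sets M" using assms(4)[of i] by measurable
  ultimately show ?thesis by (simp only: finite_measure_Diff)
qed

lemma prob_occupied_pattern_sum:
  assumes pp: "point_process M N" and [measurable]: "Measurable.pred M A"
    and fin: "finite J" and int: "\<And>j. j \<in> J \<Longrightarrow> is_interval (I j)"
  shows "\<P>(\<omega> in M. A \<omega> \<and> Q {j \<in> J. emeasure (N \<omega>) (I j) \<noteq> 0}) =
    (\<Sum>S\<in>{S. S \<subseteq> J \<and> Q S}. \<P>(\<omega> in M. A \<omega> \<and> {j \<in> J. emeasure (N \<omega>) (I j) \<noteq> 0} = S))"
proof -
  interpret prob_space M using pp by (rule point_process_prob_space)
  note [measurable] = measurable_point_count[OF pp]
  define pat where "pat \<omega> = {j \<in> J. emeasure (N \<omega>) (I j) \<noteq> 0}" for \<omega>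
  have meas: "{\<omega> \<in> space M. A \<omega> \<and> pat \<omega> = S} \<in> sets M" if "S \<subseteq> J" for S
  proof -
    have "{\<omega> \<in> space M. \<forall>j\<in>J. (emeasure (N \<omega>) (I j) \<noteq> 0) = (j \<in> S)} \<in> sets M"
      using fin int real_interval_borel_measurable by (intro sets.sets_Collect_finite_All) auto
    moreover have "{\<omega> \<in> space M. A \<omega>} \<in> sets M" by measurable
    moreover have "{\<omega> \<in> space M. A \<omega> \<and> pat \<omega> = S} = {\<omega> \<in> space M. A \<omega>} \<inter>
        {\<omega> \<in> space M. \<forall>j\<in>J. (emeasure (N \<omega>) (I j) \<noteq> 0) = (j \<in> S)}"
      using that by (auto simp: pat_def)
    ultimately show ?thesis by (simp only: sets.Int)
  qed
  have "{\<omega> \<in> space M. A \<omega> \<and> Q (pat \<omega>)} =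
      (\<Union>S\<in>{S. S \<subseteq> J \<and> Q S}. {\<omega> \<in> space M. A \<omega> \<and> pat \<omega> = S})"
    by (auto simp: pat_def)
  then show ?thesis
    unfolding pat_def[symmetric] using fin meas
    by (simp only:) (intro finite_measure_finite_Union, auto simp: disjoint_family_on_def)
qed

text \<open>Inclusion-exclusion writes the probability of any event on the pattern of charged intervals as a
  fixed linear combination of avoidance probabilities of finite unions of intervals, so convergence
  carries over. The extra event \<open>A n\<close> is the place for a restriction on a second random variable, and
  \<open>p\<close> for its limit probability.\<close>

lemma occupied_pattern_convergence:
  fixes I :: "'c \<Rightarrow> real set"
  assumes pp_n: "\<And>n. point_process (Mn n) (Nn n)" and pp: "point_process M N"
    and A [measurable]: "\<And>n. Measurable.pred (Mn n) (A n)"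
    and avoid: "\<And>U. U \<in> interval_unions \<Longrightarrow>
      (\<lambda>n. \<P>(\<omega> in Mn n. A n \<omega> \<and> emeasure (Nn n \<omega>) U = 0)) \<longlonglongrightarrow> p * \<P>(\<omega> in M. emeasure (N \<omega>) U = 0)"
    and fin: "finite J" and int: "\<And>j. j \<in> J \<Longrightarrow> is_interval (I j)"
  shows "(\<lambda>n. \<P>(\<omega> in Mn n. A n \<omega> \<and> Q {j \<in> J. emeasure (Nn n \<omega>) (I j) \<noteq> 0}))
    \<longlonglongrightarrow> p * \<P>(\<omega> in M. Q {j \<in> J. emeasure (N \<omega>) (I j) \<noteq> 0})"
proof -
  have step: "(\<lambda>n. \<P>(\<omega> in Mn n. A n \<omega> \<and> emeasure (Nn n \<omega>) U = 0 \<and> (\<forall>j\<in>T. emeasure (Nn n \<omega>) (I j) \<noteq> 0)))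
      \<longlonglongrightarrow> p * \<P>(\<omega> in M. emeasure (N \<omega>) U = 0 \<and> (\<forall>j\<in>T. emeasure (N \<omega>) (I j) \<noteq> 0))"
    if "finite T" "T \<subseteq> J" "U \<in> interval_unions" for T U
    using that
  proof (induction T arbitrary: U rule: finite_induct)
    case empty
    then show ?case using avoid by simp
  next
    case (insert i T)
    \<comment> \<open>The set to be avoided grows along the induction, so the claim is proved for all \<open>U\<close> at once.\<close>
    have U: "U \<in> interval_unions" "U \<union> I i \<in> interval_unions"
      using insert.prems int interval_unions_Un[OF _ interval_in_interval_unions] by auto
    have borel: "\<And>j. j \<in> insert i T \<Longrightarrow> I j \<in> sets borel" "U \<in> sets borel"
      using insert.prems int real_interval_borel_measurable interval_unions_borel by blast+
    have "T \<subseteq> J" using insert.prems by simp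
    note lim = tendsto_diff[OF insert.IH[OF this U(1)] insert.IH[OF this U(2)]]
    have "\<P>(\<omega> in M. emeasure (N \<omega>) U = 0 \<and> (\<forall>j\<in>insert i T. emeasure (N \<omega>) (I j) \<noteq> 0)) =
        \<P>(\<omega> in M. emeasure (N \<omega>) U = 0 \<and> (\<forall>j\<in>T. emeasure (N \<omega>) (I j) \<noteq> 0)) -
        \<P>(\<omega> in M. emeasure (N \<omega>) (U \<union> I i) = 0 \<and> (\<forall>j\<in>T. emeasure (N \<omega>) (I j) \<noteq> 0))"
      using occupied_pattern_prob_insert[OF pp _ insert.hyps(1) borel, of "\<lambda>_. True"] by simp
    moreover have "\<P>(\<omega> in Mn n. A n \<omega> \<and> emeasure (Nn n \<omega>) U = 0 \<and> (\<forall>j\<in>insert i T. emeasure (Nn n \<omega>) (I j) \<noteq> 0)) =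
        \<P>(\<omega> in Mn n. A n \<omega> \<and> emeasure (Nn n \<omega>) U = 0 \<and> (\<forall>j\<in>T. emeasure (Nn n \<omega>) (I j) \<noteq> 0)) -
        \<P>(\<omega> in Mn n. A n \<omega> \<and> emeasure (Nn n \<omega>) (U \<union> I i) = 0 \<and> (\<forall>j\<in>T. emeasure (Nn n \<omega>) (I j) \<noteq> 0))" for n
      by (rule occupied_pattern_prob_insert[OF pp_n A insert.hyps(1) borel])
    ultimately show ?case using lim by (simp only: right_diff_distrib)
  qed
  have pattern_iff: "{j \<in> J. emeasure \<mu> (I j) \<noteq> 0} = S \<longleftrightarrow>
      emeasure \<mu> (\<Union>j\<in>J - S. I j) = 0 \<and> (\<forall>j\<in>S. emeasure \<mu> (I j) \<noteq> 0)"
    if "\<mu> \<in> pt_measures" "S \<subseteq> J" for \<mu> S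
  proof -
    have "emeasure \<mu> (\<Union>j\<in>J - S. I j) = 0 \<longleftrightarrow> (\<forall>j\<in>J - S. emeasure \<mu> (I j) = 0)"
      using that int fin by (intro avoids_UN real_interval_borel_measurable) auto
    with that show ?thesis by auto
  qed
  define pat where "pat \<mu> = {j \<in> J. emeasure \<mu> (I j) \<noteq> 0}" for \<mu>
  define SS where "SS = {S. S \<subseteq> J \<and> Q S}"
  have "finite SS" using fin by (simp add: SS_def)
  have pattern: "(\<lambda>n. \<P>(\<omega> in Mn n. A n \<omega> \<and> pat (Nn n \<omega>) = S)) \<longlonglongrightarrow> p * \<P>(\<omega> in M. pat (N \<omega>) = S)"
    if "S \<in> SS" for S
  proof -
    have S: "S \<subseteq> J" "finite S" using that fin finite_subset by (auto simp: SS_def)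
    have "(\<Union>j\<in>J - S. I j) \<in> interval_unions" using fin int by (intro interval_unionsI) auto
    from step[OF S(2,1) this] show ?thesis
      unfolding pat_def
      using pattern_iff[OF point_process_in_pt_measures[OF pp_n] S(1)]
        pattern_iff[OF point_process_in_pt_measures[OF pp] S(1)]
      by (simp cong: conj_cong)
  qed
  have sum_n: "\<P>(\<omega> in Mn n. A n \<omega> \<and> Q (pat (Nn n \<omega>))) = (\<Sum>S\<in>SS. \<P>(\<omega> in Mn n. A n \<omega> \<and> pat (Nn n \<omega>) = S))" for n
    unfolding SS_def pat_def by (intro prob_occupied_pattern_sum pp_n A fin int)
  have sum: "\<P>(\<omega> in M. Q (pat (N \<omega>))) = (\<Sum>S\<in>SS. \<P>(\<omega> in M. pat (N \<omega>) = S))"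
    unfolding SS_def pat_def
    using prob_occupied_pattern_sum[OF pp _ fin int, of "\<lambda>_. True"] by simp
  have "(\<lambda>n. \<Sum>S\<in>SS. \<P>(\<omega> in Mn n. A n \<omega> \<and> pat (Nn n \<omega>) = S)) \<longlonglongrightarrow>
      (\<Sum>S\<in>SS. p * \<P>(\<omega> in M. pat (N \<omega>) = S))"
    by (intro tendsto_sum pattern)
  then show ?thesis
    unfolding sum_n[symmetric] sum_distrib_left[symmetric] sum[symmetric] by (simp only: pat_def)
qed

section \<open>Rarely crowded cells\<close>

lemma prob_tendsto_0_if_AE_eventually_not:
  assumes "prob_space M" and [measurable]: "\<And>m. Measurable.pred M (bad m)"
    and ev: "AE \<omega> in M. eventually (\<lambda>m::nat. \<not> bad m \<omega>) sequentially"
  shows "(\<lambda>m. \<P>(\<omega> in M. bad m \<omega>)) \<longlonglongrightarrow> 0"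
proof -
  interpret prob_space M by fact
  have "(\<lambda>m. \<integral>\<omega>. indicator {\<omega> \<in> space M. bad m \<omega>} \<omega> \<partial>M) \<longlonglongrightarrow> (\<integral>\<omega>. (0::real) \<partial>M)"
  proof (rule integral_dominated_convergence[where w = "\<lambda>_. 1"])
    show "AE \<omega> in M. (\<lambda>m. indicator {\<omega> \<in> space M. bad m \<omega>} \<omega>) \<longlonglongrightarrow> (0::real)"
      using ev by eventually_elim (rule tendsto_eventually, auto elim!: eventually_mono)
  qed (auto simp: indicator_def)
  then show ?thesis by simp
qed

lemma pred_crowded:
  assumes "point_process M N"
  shows "Measurable.pred M (\<lambda>\<omega>. crowded m R (N \<omega>))"
proof -
  note [measurable] = measurable_point_count[OF assms]
  have "{\<omega> \<in> space M. \<exists>j\<in>window m R. emeasure (N \<omega>) (cell m j) > 1} \<in> sets M"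
    by (intro sets.sets_Collect_finite_Ex) auto
  then show ?thesis by (simp add: pred_def crowded_def)
qed

lemma card_occupied_eq_sum:
  "of_nat (card (occupied m R \<mu>)) = (\<Sum>j\<in>window m R. if emeasure \<mu> (cell m j) \<noteq> 0 then 1 else 0 :: ennreal)"
  by (subst sum.inter_filter[symmetric]) (auto simp: occupied_def)

lemma hitting_prob:
  assumes pp: "point_process M N" and [measurable]: "B \<in> sets borel"
  shows "\<P>(\<omega> in M. emeasure (N \<omega>) B \<noteq> 0) = 1 - \<P>(\<omega> in M. emeasure (N \<omega>) B = 0)"
proof -
  interpret prob_space M using pp by (rule point_process_prob_space)
  note [measurable] = measurable_point_count[OF pp]
  show ?thesis by (rule prob_neg) measurable
qed

lemma measurable_card_occupied:
  assumes "point_process M N"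
  shows "(\<lambda>\<omega>. of_nat (card (occupied m R (N \<omega>))) :: ennreal) \<in> borel_measurable M"
  unfolding card_occupied_eq_sum
  using measurable_point_count[OF assms, measurable] by measurable

lemma expected_card_occupied:
  assumes "point_process M N"
  shows "(\<integral>\<^sup>+\<omega>. of_nat (card (occupied m R (N \<omega>))) \<partial>M) =
    ennreal (\<Sum>j\<in>window m R. \<P>(\<omega> in M. emeasure (N \<omega>) (cell m j) \<noteq> 0))"
proof -
  interpret prob_space M using assms by (rule point_process_prob_space)
  note [measurable] = measurable_point_count[OF assms]
  have "(\<integral>\<^sup>+\<omega>. (if emeasure (N \<omega>) (cell m j) \<noteq> 0 then 1 else 0) \<partial>M) =
      ennreal (\<P>(\<omega> in M. emeasure (N \<omega>) (cell m j) \<noteq> 0))" for j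
  proof -
    have "(\<integral>\<^sup>+\<omega>. (if emeasure (N \<omega>) (cell m j) \<noteq> 0 then 1 else 0) \<partial>M) =
        (\<integral>\<^sup>+\<omega>. indicator {\<omega> \<in> space M. emeasure (N \<omega>) (cell m j) \<noteq> 0} \<omega> \<partial>M)"
      by (intro nn_integral_cong) (auto simp: indicator_def)
    also have "\<dots> = emeasure M {\<omega> \<in> space M. emeasure (N \<omega>) (cell m j) \<noteq> 0}"
      by (intro nn_integral_indicator) measurable
    finally show ?thesis by (simp add: emeasure_eq_measure)
  qed
  then show ?thesis
    unfolding card_occupied_eq_sum by (subst nn_integral_sum) (auto simp: sum_ennreal)
qed

text \<open>The expectation of the pathwise bound by the number of points in the window; it holds for every
  point process, so the same bound serves the approximating processes and the limit.\<close>

lemma crowded_prob_bound: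
  assumes pp: "point_process M N"
  shows "ennreal (\<P>(\<omega> in M. crowded m R (N \<omega>)) +
      (\<Sum>j\<in>window m R. \<P>(\<omega> in M. emeasure (N \<omega>) (cell m j) \<noteq> 0)))
    \<le> intensity M N {- real R <.. real R}"
proof -
  interpret prob_space M using pp by (rule point_process_prob_space)
  note [measurable] = measurable_point_count[OF pp] measurable_card_occupied[OF pp] pred_crowded[OF pp]
  let ?C = "{\<omega> \<in> space M. crowded m R (N \<omega>)}"
  have C: "?C \<in> sets M" by measurable
  have "ennreal (measure M ?C + (\<Sum>j\<in>window m R. \<P>(\<omega> in M. emeasure (N \<omega>) (cell m j) \<noteq> 0)))
      = emeasure M ?C + (\<integral>\<^sup>+\<omega>. of_nat (card (occupied m R (N \<omega>))) \<partial>M)"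
    unfolding expected_card_occupied[OF pp] emeasure_eq_measure by (intro ennreal_plus sum_nonneg) auto
  also have "\<dots> = (\<integral>\<^sup>+\<omega>. indicator ?C \<omega> + of_nat (card (occupied m R (N \<omega>))) \<partial>M)"
    using C by (subst nn_integral_add) auto
  also have "\<dots> \<le> (\<integral>\<^sup>+\<omega>. emeasure (N \<omega>) {- real R <.. real R} \<partial>M)"
  proof (rule nn_integral_mono)
    fix \<omega> assume \<omega>: "\<omega> \<in> space M"
    have "indicator ?C \<omega> = (indicator {\<mu>. crowded m R \<mu>} (N \<omega>) :: ennreal)"
      using \<omega> by (auto simp: indicator_def)
    with card_occupied_crowded_le[OF point_process_in_pt_measures[OF pp \<omega>], of m R]
    show "indicator ?C \<omega> + of_nat (card (occupied m R (N \<omega>))) \<le> emeasure (N \<omega>) {- real R <.. real R}"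
      by (simp add: add.commute)
  qed
  finally show ?thesis by (simp add: intensity_def)
qed

lemma simple_eventually_not_crowded:
  assumes "simple_point_process M N"
  shows "AE \<omega> in M. eventually (\<lambda>m. \<not> crowded m R (N \<omega>)) sequentially"
proof -
  have pp: "point_process M N"
    and atoms: "AE \<omega> in M. \<forall>x. emeasure (N \<omega>) {x} \<noteq> 0 \<longrightarrow> emeasure (N \<omega>) {x} = 1"
    using assms by (auto simp: simple_point_process_def)
  from atoms AE_space show ?thesis
  proof eventually_elim
    case (elim \<omega>)
    have "emeasure (N \<omega>) {x} \<le> 1" for x
      using elim(1) by (cases "emeasure (N \<omega>) {x} = 0") auto
    with point_process_in_pt_measures[OF pp elim(2)] show ?case by (rule eventually_not_crowded)
  qed
qed

text \<open>For a simple process the number of occupied cells of level \<open>m\<close> in the window tends to the number of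
  points there, and it is dominated by that number, whose expectation is finite. The bound on
  crowding is therefore asymptotically sharp.\<close>

lemma occupied_probs_tendsto_intensity:
  assumes simple: "simple_point_process M N" and lfi: "locally_finite_intensity M N"
  shows "(\<lambda>m. \<Sum>j\<in>window m R. \<P>(\<omega> in M. emeasure (N \<omega>) (cell m j) \<noteq> 0))
    \<longlonglongrightarrow> enn2real (intensity M N {- real R <.. real R})"
proof -
  have pp: "point_process M N" using simple by (simp add: simple_point_process_def)
  interpret prob_space M using pp by (rule point_process_prob_space)
  let ?W = "{- real R <.. real R}"
  have fin: "intensity M N ?W < \<infinity>"
    using lfi by (auto simp: locally_finite_intensity_def is_interval_oc)
  have "(\<lambda>m. \<integral>\<^sup>+\<omega>. of_nat (card (occupied m R (N \<omega>))) \<partial>M) \<longlonglongrightarrow> (\<integral>\<^sup>+\<omega>. emeasure (N \<omega>) ?W \<partial>M)"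
  proof (rule nn_integral_dominated_convergence[where w = "\<lambda>\<omega>. emeasure (N \<omega>) ?W"])
    show "AE \<omega> in M. of_nat (card (occupied m R (N \<omega>))) \<le> emeasure (N \<omega>) ?W" for m
    proof (rule AE_I2)
      fix \<omega> assume "\<omega> \<in> space M"
      from card_occupied_crowded_le[OF point_process_in_pt_measures[OF pp this], of m R]
      show "of_nat (card (occupied m R (N \<omega>))) \<le> emeasure (N \<omega>) ?W"
        by (rule order.trans[rotated]) simp
    qed
    show "AE \<omega> in M. (\<lambda>m. of_nat (card (occupied m R (N \<omega>)))) \<longlonglongrightarrow> emeasure (N \<omega>) ?W"
      using simple_eventually_not_crowded[OF simple, of R] AE_space
    proof eventually_elim
      case (elim \<omega>)
      show ?case
      proof (rule tendsto_eventually, use elim(1) in eventually_elim)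
        case (elim m)
        have sub: "cell m j \<subseteq> ?W" if "j \<in> window m R" for j
          using cell_subset_window that .
        then have "straddling m R ?W = {}" by (auto simp: straddling_def)
        then have "emeasure (N \<omega>) ?W = of_nat (card {j \<in> occupied m R (N \<omega>). cell m j \<subseteq> ?W})"
          using elim point_process_in_pt_measures[OF pp \<open>\<omega> \<in> space M\<close>]
          by (intro emeasure_eq_card_occupied) auto
        also have "{j \<in> occupied m R (N \<omega>). cell m j \<subseteq> ?W} = occupied m R (N \<omega>)"
          using sub by (auto simp: occupied_def)
        finally show ?case by simp
      qed
    qed
  qed (use measurable_card_occupied[OF pp] measurable_point_count[OF pp] fin in \<open>auto simp: intensity_def\<close>)
  then have "(\<lambda>m. ennreal (\<Sum>j\<in>window m R. \<P>(\<omega> in M. emeasure (N \<omega>) (cell m j) \<noteq> 0))) \<longlonglongrightarrow>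
      ennreal (enn2real (intensity M N ?W))"
    using fin by (simp add: expected_card_occupied[OF pp] intensity_def)
  then show ?thesis by (subst (asm) tendsto_ennreal_iff) (auto intro!: always_eventually sum_nonneg)
qed

lemma (in prob_space) prob_diff_le_prob_differ:
  assumes [measurable]: "Measurable.pred M P" "Measurable.pred M Q" "Measurable.pred M bad"
    and differ: "\<And>\<omega>. \<omega> \<in> space M \<Longrightarrow> \<not> bad \<omega> \<Longrightarrow> P \<omega> \<longleftrightarrow> Q \<omega>"
  shows "\<bar>\<P>(\<omega> in M. P \<omega>) - \<P>(\<omega> in M. Q \<omega>)\<bar> \<le> \<P>(\<omega> in M. bad \<omega>)"
proof -
  let ?P = "{\<omega> \<in> space M. P \<omega>}" and ?Q = "{\<omega> \<in> space M. Q \<omega>}" and ?B = "{\<omega> \<in> space M. bad \<omega>}"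
  have [simp]: "?P \<in> sets M" "?Q \<in> sets M" "?B \<in> sets M" by measurable
  have "prob ?P \<le> prob (?Q \<union> ?B)" "prob ?Q \<le> prob (?P \<union> ?B)"
    using differ by (auto intro!: finite_measure_mono)
  moreover have "prob (?Q \<union> ?B) \<le> prob ?Q + prob ?B" "prob (?P \<union> ?B) \<le> prob ?P + prob ?B"
    by (auto intro!: measure_Un_le)
  ultimately show ?thesis by linarith
qed

lemma pred_counts:
  assumes pp: "point_process M N" and "finite K"
    and "\<And>i. i \<in> K \<Longrightarrow> B i \<in> sets borel" "\<And>i. i \<in> K \<Longrightarrow> L i \<in> sets borel"
  shows "Measurable.pred M (\<lambda>\<omega>. \<forall>i\<in>K. emeasure (N \<omega>) (B i) \<in> L i)"
  unfolding pred_def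
proof (intro sets.sets_Collect_finite_All assms(2))
  fix i assume "i \<in> K"
  with assms have "(\<lambda>\<omega>. emeasure (N \<omega>) (B i)) \<in> borel_measurable M" "L i \<in> sets borel"
    by (auto intro: measurable_point_count)
  then show "{\<omega> \<in> space M. emeasure (N \<omega>) (B i) \<in> L i} \<in> sets M" by measurable
qed

text \<open>The count is a finite sum of indicators over the window, which reduces measurability to that of the
  events that a single cell is charged.\<close>

lemma pred_occupied_counts:
  fixes L :: "'i \<Rightarrow> ennreal set"
  assumes pp: "point_process M N" and "finite K" and L: "\<And>i. i \<in> K \<Longrightarrow> L i \<in> sets borel"
  shows "Measurable.pred M (\<lambda>\<omega>. \<forall>i\<in>K. of_nat (card {j \<in> occupied m R (N \<omega>). C j i}) \<in> L i)"
  unfolding pred_def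
proof (intro sets.sets_Collect_finite_All assms(2))
  fix i assume i: "i \<in> K"
  note [measurable] = measurable_point_count[OF pp] L[OF i]
  have eq: "of_nat (card {j \<in> occupied m R \<mu>. C j i}) =
      (\<Sum>j\<in>{j \<in> window m R. C j i}. if emeasure \<mu> (cell m j) \<noteq> 0 then 1 else 0 :: ennreal)" for \<mu>
    by (subst sum.inter_filter[symmetric]) (auto simp: occupied_def intro!: arg_cong[where f = card])
  show "{\<omega> \<in> space M. of_nat (card {j \<in> occupied m R (N \<omega>). C j i}) \<in> L i} \<in> sets M"
    unfolding eq by measurable
qed

lemma pred_bad:
  assumes pp: "point_process M N" and "finite K"
  shows "Measurable.pred M (\<lambda>\<omega>. crowded m R (N \<omega>) \<or> (\<exists>i\<in>K. emeasure (N \<omega>) (straddling m R (B i)) \<noteq> 0))"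
proof -
  note [measurable] = measurable_point_count[OF pp] pred_crowded[OF pp]
  have "{\<omega> \<in> space M. \<exists>i\<in>K. emeasure (N \<omega>) (straddling m R (B i)) \<noteq> 0} \<in> sets M"
    by (intro sets.sets_Collect_finite_Ex assms(2)) measurable
  then have [measurable]: "Measurable.pred M (\<lambda>\<omega>. \<exists>i\<in>K. emeasure (N \<omega>) (straddling m R (B i)) \<noteq> 0)"
    by (simp add: pred_def)
  show ?thesis by measurable
qed

text \<open>One summand \<open>d\<close> accounts for the crowded cells and one for each of the sets \<open>B i\<close>.\<close>

lemma prob_bad_bound:
  assumes pp: "point_process M N" and fin: "finite K"
    and cr: "\<P>(\<omega> in M. crowded m R (N \<omega>)) \<le> d"
    and str: "\<And>i. i \<in> K \<Longrightarrow> \<P>(\<omega> in M. emeasure (N \<omega>) (straddling m R (B i)) \<noteq> 0) \<le> d"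
  shows "\<P>(\<omega> in M. crowded m R (N \<omega>) \<or> (\<exists>i\<in>K. emeasure (N \<omega>) (straddling m R (B i)) \<noteq> 0))
    \<le> d + real (card K) * d"
proof -
  interpret prob_space M using pp by (rule point_process_prob_space)
  note [measurable] = measurable_point_count[OF pp] pred_crowded[OF pp]
  let ?C = "{\<omega> \<in> space M. crowded m R (N \<omega>)}"
  let ?S = "\<lambda>i. {\<omega> \<in> space M. emeasure (N \<omega>) (straddling m R (B i)) \<noteq> 0}"
  have C: "?C \<in> sets M" by measurable
  have S: "?S i \<in> sets M" for i by measurable
  have "prob (\<Union>i\<in>K. ?S i) \<le> (\<Sum>i\<in>K. prob (?S i))"
    using fin S by (intro finite_measure_subadditive_finite) auto
  also have "\<dots> \<le> real (card K) * d" using str by (intro sum_bounded_above) auto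
  finally have "prob (\<Union>i\<in>K. ?S i) \<le> real (card K) * d" .
  moreover have "(\<Union>i\<in>K. ?S i) \<in> sets M" using fin S by (intro sets.finite_UN) auto
  ultimately have "prob (?C \<union> (\<Union>i\<in>K. ?S i)) \<le> d + real (card K) * d"
    using cr measure_Un_le[of ?C M "\<Union>i\<in>K. ?S i"] C by linarith
  also have "?C \<union> (\<Union>i\<in>K. ?S i) =
      {\<omega> \<in> space M. crowded m R (N \<omega>) \<or> (\<exists>i\<in>K. emeasure (N \<omega>) (straddling m R (B i)) \<noteq> 0)}"
    by auto
  finally show ?thesis .
qed

section \<open>From avoidance probabilities to joint counts\<close>

text \<open>The unmarked part of the hypotheses; a second random variable enters only through the events \<open>A n\<close>
  of the lemma on joint counts below.\<close>

locale avoidance_and_intensity_convergence =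
  fixes Mn :: "nat \<Rightarrow> 'a measure" and Nn :: "nat \<Rightarrow> 'a \<Rightarrow> real measure"
    and M :: "'b measure" and N :: "'b \<Rightarrow> real measure"
  assumes pp_n: "\<And>n. point_process (Mn n) (Nn n)"
    and simple: "simple_point_process M N"
    and lfi: "locally_finite_intensity M N"
    and intensity_limsup: "\<And>I. is_interval I \<Longrightarrow>
      limsup (\<lambda>n. intensity (Mn n) (Nn n) I) \<le> intensity M N I"
    and avoidance: "\<And>U. U \<in> interval_unions \<Longrightarrow>
      (\<lambda>n. \<P>(\<omega> in Mn n. emeasure (Nn n \<omega>) U = 0)) \<longlonglongrightarrow> \<P>(\<omega> in M. emeasure (N \<omega>) U = 0)"
begin

lemma pp: "point_process M N"
  using simple by (simp add: simple_point_process_def)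

lemma prob_n: "prob_space (Mn n)"
  using pp_n by (rule point_process_prob_space)

lemma prob: "prob_space M"
  using pp by (rule point_process_prob_space)

lemma hitting:
  assumes U: "U \<in> interval_unions"
  shows "(\<lambda>n. \<P>(\<omega> in Mn n. emeasure (Nn n \<omega>) U \<noteq> 0)) \<longlonglongrightarrow> \<P>(\<omega> in M. emeasure (N \<omega>) U \<noteq> 0)"
  unfolding hitting_prob[OF pp_n interval_unions_borel[OF U]] hitting_prob[OF pp interval_unions_borel[OF U]]
  by (intro tendsto_diff tendsto_const avoidance U)

text \<open>Here the bound on the intensities is used. At a fixed level, the probability that \<open>Nn n\<close> has a
  crowded cell is at most the mean number of points of \<open>Nn n\<close> in the window, which is asymptotically
  at most that of \<open>N\<close>, minus the mean number of occupied cells, which converges to that of \<open>N\<close>. The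
  difference of the two limits is small once the level is large.\<close>

lemma eventually_rarely_crowded:
  assumes e: "0 < e"
  shows "eventually (\<lambda>m. \<P>(\<omega> in M. crowded m R (N \<omega>)) < e \<and>
    eventually (\<lambda>n. \<P>(\<omega> in Mn n. crowded m R (Nn n \<omega>)) < e) sequentially) sequentially"
proof -
  let ?W = "{- real R <.. real R}"
  define s where "s m = (\<Sum>j\<in>window m R. \<P>(\<omega> in M. emeasure (N \<omega>) (cell m j) \<noteq> 0))" for m
  define sn where "sn n m = (\<Sum>j\<in>window m R. \<P>(\<omega> in Mn n. emeasure (Nn n \<omega>) (cell m j) \<noteq> 0))" for n m
  define a where "a = enn2real (intensity M N ?W)"
  have fin: "intensity M N ?W < \<infinity>"
    using lfi by (auto simp: locally_finite_intensity_def is_interval_oc)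
  then have a: "intensity M N ?W = ennreal a" "0 \<le> a" by (auto simp: a_def)
  have "s \<longlonglongrightarrow> a"
    using occupied_probs_tendsto_intensity[OF simple lfi, of R] by (simp add: s_def[abs_def] a_def)
  then have "eventually (\<lambda>m. a - e / 3 < s m) sequentially"
    using e by (intro order_tendstoD) auto
  then show ?thesis
  proof eventually_elim
    case (elim m)
    \<comment> \<open>The three thirds of \<open>e\<close>: the gap \<open>a - s m\<close>, the excess of the intensity, and the error of \<open>sn n m\<close>.\<close>
    have "ennreal (\<P>(\<omega> in M. crowded m R (N \<omega>)) + s m) \<le> ennreal a"
      using crowded_prob_bound[OF pp, of m R] by (simp add: s_def a)
    then have "\<P>(\<omega> in M. crowded m R (N \<omega>)) + s m \<le> a"
      using a(2) by (simp add: ennreal_le_iff)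
    then have "\<P>(\<omega> in M. crowded m R (N \<omega>)) < e" using elim e by linarith
    have "(\<lambda>n. sn n m) \<longlonglongrightarrow> s m"
      unfolding sn_def s_def by (intro tendsto_sum hitting interval_in_interval_unions is_interval_cell)
    then have "eventually (\<lambda>n. a - 2 * e / 3 < sn n m) sequentially"
      using elim e by (intro order_tendstoD) auto
    moreover have "ennreal a < ennreal (a + e / 3)" using a(2) e by (subst ennreal_less_iff) auto
    then have "eventually (\<lambda>n. intensity (Mn n) (Nn n) ?W < ennreal (a + e / 3)) sequentially"
      using intensity_limsup[of ?W] a(1) by (intro Limsup_lessD) (auto simp: is_interval_oc)
    ultimately have "eventually (\<lambda>n. \<P>(\<omega> in Mn n. crowded m R (Nn n \<omega>)) < e) sequentially"
    proof eventually_elim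
      case (elim n)
      have "ennreal (\<P>(\<omega> in Mn n. crowded m R (Nn n \<omega>)) + sn n m) < ennreal (a + e / 3)"
        using crowded_prob_bound[OF pp_n[of n], of m R] elim(2) unfolding sn_def by (rule le_less_trans)
      then have "\<P>(\<omega> in Mn n. crowded m R (Nn n \<omega>)) + sn n m < a + e / 3"
        by (subst (asm) ennreal_less_iff) (auto simp: sn_def intro!: add_nonneg_nonneg sum_nonneg)
      with elim(1) show ?case by linarith
    qed
    with \<open>\<P>(\<omega> in M. crowded m R (N \<omega>)) < e\<close> show ?case by simp
  qed
qed

text \<open>The core of the argument. Unless some cell is crowded or charged and straddling one of the sets
  \<open>B i\<close>, the counts \<open>N(B i)\<close> are read off from the pattern of occupied cells, and events on the
  pattern converge. The exceptional event has small probability, uniformly for large \<open>n\<close>, when the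
  level is large. The two families of sets to which this applies are the dyadic cells, for which
  straddling stops at a finite level, and the continuity sets of \<open>N\<close>.\<close>

lemma count_convergence:
  assumes A [measurable]: "\<And>n. Measurable.pred (Mn n) (A n)"
    and avoidA: "\<And>U. U \<in> interval_unions \<Longrightarrow>
      (\<lambda>n. \<P>(\<omega> in Mn n. A n \<omega> \<and> emeasure (Nn n \<omega>) U = 0)) \<longlonglongrightarrow> p * \<P>(\<omega> in M. emeasure (N \<omega>) U = 0)"
    and fin: "finite K"
    and B: "\<And>i. i \<in> K \<Longrightarrow> B i \<in> sets borel" "\<And>i. i \<in> K \<Longrightarrow> bounded (B i)"
    and str: "\<And>i R. i \<in> K \<Longrightarrow> (\<lambda>m. \<P>(\<omega> in M. emeasure (N \<omega>) (straddling m R (B i)) \<noteq> 0)) \<longlonglongrightarrow> 0"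
    and L: "\<And>i. i \<in> K \<Longrightarrow> L i \<in> sets borel"
  shows "(\<lambda>n. \<P>(\<omega> in Mn n. A n \<omega> \<and> (\<forall>i\<in>K. emeasure (Nn n \<omega>) (B i) \<in> L i)))
    \<longlonglongrightarrow> p * \<P>(\<omega> in M. \<forall>i\<in>K. emeasure (N \<omega>) (B i) \<in> L i)"
proof -
  have "bounded (\<Union>i\<in>K. B i)" using fin B(2) by (intro bounded_UN) auto
  then obtain r where r: "\<And>x. x \<in> (\<Union>i\<in>K. B i) \<Longrightarrow> \<bar>x\<bar> \<le> r" by (auto simp: bounded_iff)
  obtain R :: nat where "r < real R" using reals_Archimedean2 by blast
  then have BR: "B i \<subseteq> {- real R <.. real R}" if "i \<in> K" for i using r that by force

  \<comment> \<open>As a limit of probabilities, \<open>p\<close> does not enlarge the error made in replacing counts by patterns.\<close>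
  have p: "\<bar>p\<bar> \<le> 1"
  proof -
    interpret M: prob_space M by (rule prob)
    have "(\<lambda>n. \<P>(\<omega> in Mn n. A n \<omega>)) \<longlonglongrightarrow> p"
      using avoidA[OF empty_in_interval_unions] by (simp add: M.prob_space)
    then have "(\<lambda>n. \<bar>\<P>(\<omega> in Mn n. A n \<omega>)\<bar>) \<longlonglongrightarrow> \<bar>p\<bar>" by (rule tendsto_rabs)
    then show ?thesis
      by (rule LIMSEQ_le_const2) (auto intro!: exI[of _ 0] prob_space.prob_le_1 prob_n)
  qed

  define bad where "bad m \<mu> \<longleftrightarrow> crowded m R \<mu> \<or> (\<exists>i\<in>K. emeasure \<mu> (straddling m R (B i)) \<noteq> 0)" for m \<mu>
  define X where "X \<mu> \<longleftrightarrow> (\<forall>i\<in>K. emeasure \<mu> (B i) \<in> L i)" for \<mu>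
  define Q where "Q m S \<longleftrightarrow> (\<forall>i\<in>K. of_nat (card {j \<in> S. cell m j \<subseteq> B i}) \<in> L i)" for m S
  have X_eq: "X \<mu> \<longleftrightarrow> Q m (occupied m R \<mu>)" if "\<mu> \<in> pt_measures" "\<not> bad m \<mu>" for \<mu> m
    unfolding X_def Q_def
    using emeasure_eq_card_occupied[OF that(1) B(1) BR] that(2) by (auto simp: bad_def)

  have eps: "eventually (\<lambda>n. \<bar>\<P>(\<omega> in Mn n. A n \<omega> \<and> X (Nn n \<omega>)) - p * \<P>(\<omega> in M. X (N \<omega>))\<bar> < 3 * e) sequentially"
    if e: "0 < e" for e :: real
  proof -
    \<comment> \<open>There are \<open>card K + 1\<close> sources of exceptional events: crowding, and straddling for each \<open>i\<close>.\<close>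
    define d where "d = e / (real (card K) + 1)"
    have d: "0 < d" "d + real (card K) * d = e"
    proof -
      have "d + real (card K) * d = d * (real (card K) + 1)" by (simp add: algebra_simps)
      then show "d + real (card K) * d = e" by (simp add: d_def)
    qed (use e in \<open>simp add: d_def\<close>)
    have "eventually (\<lambda>m. \<forall>i\<in>K. \<P>(\<omega> in M. emeasure (N \<omega>) (straddling m R (B i)) \<noteq> 0) < d) sequentially"
      using fin str d(1) by (intro eventually_ball_finite ballI order_tendstoD(2)) auto
    with eventually_rarely_crowded[OF d(1), of R]
    have "eventually (\<lambda>m. \<P>(\<omega> in M. crowded m R (N \<omega>)) < d \<and>
        eventually (\<lambda>n. \<P>(\<omega> in Mn n. crowded m R (Nn n \<omega>)) < d) sequentially \<and>
        (\<forall>i\<in>K. \<P>(\<omega> in M. emeasure (N \<omega>) (straddling m R (B i)) \<noteq> 0) < d)) sequentially"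
      by eventually_elim auto
    from eventually_happens'[OF sequentially_bot this]
    obtain m where m: "\<P>(\<omega> in M. crowded m R (N \<omega>)) < d"
        "eventually (\<lambda>n. \<P>(\<omega> in Mn n. crowded m R (Nn n \<omega>)) < d) sequentially"
        "\<And>i. i \<in> K \<Longrightarrow> \<P>(\<omega> in M. emeasure (N \<omega>) (straddling m R (B i)) \<noteq> 0) < d"
      by blast
    have bad: "\<P>(\<omega> in M. bad m (N \<omega>)) \<le> e"
      unfolding d(2)[symmetric] bad_def
      using m(1,3) by (intro prob_bad_bound pp fin) (auto intro: less_imp_le)
    have "eventually (\<lambda>n. \<forall>i\<in>K. \<P>(\<omega> in Mn n. emeasure (Nn n \<omega>) (straddling m R (B i)) \<noteq> 0) < d) sequentially"
      using fin m(3)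
      by (intro eventually_ball_finite ballI order_tendstoD(2)[OF hitting[OF straddling_interval_union]]) auto
    with m(2) have bad_n: "eventually (\<lambda>n. \<P>(\<omega> in Mn n. bad m (Nn n \<omega>)) \<le> e) sequentially"
    proof eventually_elim
      case (elim n)
      then show ?case
        unfolding d(2)[symmetric] bad_def
        by (intro prob_bad_bound pp_n fin) (auto intro: less_imp_le)
    qed
    have "(\<lambda>n. \<P>(\<omega> in Mn n. A n \<omega> \<and> Q m (occupied m R (Nn n \<omega>)))) \<longlonglongrightarrow>
        p * \<P>(\<omega> in M. Q m (occupied m R (N \<omega>)))"
      unfolding occupied_def
      by (rule occupied_pattern_convergence[OF pp_n pp A avoidA]) (auto intro: is_interval_cell)
    then have "eventually (\<lambda>n. dist \<P>(\<omega> in Mn n. A n \<omega> \<and> Q m (occupied m R (Nn n \<omega>)))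
        (p * \<P>(\<omega> in M. Q m (occupied m R (N \<omega>)))) < e) sequentially"
      using e by (rule tendstoD)
    with bad_n show ?thesis
    proof eventually_elim
      case (elim n)
      have "\<bar>\<P>(\<omega> in Mn n. A n \<omega> \<and> X (Nn n \<omega>)) - \<P>(\<omega> in Mn n. A n \<omega> \<and> Q m (occupied m R (Nn n \<omega>)))\<bar>
          \<le> \<P>(\<omega> in Mn n. bad m (Nn n \<omega>))"
      proof (rule prob_space.prob_diff_le_prob_differ[OF prob_n])
        have [measurable]: "Measurable.pred (Mn n) (\<lambda>\<omega>. X (Nn n \<omega>))"
            "Measurable.pred (Mn n) (\<lambda>\<omega>. Q m (occupied m R (Nn n \<omega>)))"
          unfolding X_def Q_def
          using B L fin by (intro pred_counts pred_occupied_counts pp_n; simp)+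
        show "Measurable.pred (Mn n) (\<lambda>\<omega>. A n \<omega> \<and> X (Nn n \<omega>))"
            "Measurable.pred (Mn n) (\<lambda>\<omega>. A n \<omega> \<and> Q m (occupied m R (Nn n \<omega>)))"
          by measurable
        show "Measurable.pred (Mn n) (\<lambda>\<omega>. bad m (Nn n \<omega>))"
          unfolding bad_def by (intro pred_bad pp_n fin)
      qed (use X_eq point_process_in_pt_measures[OF pp_n] in blast)
      moreover have "\<bar>\<P>(\<omega> in M. X (N \<omega>)) - \<P>(\<omega> in M. Q m (occupied m R (N \<omega>)))\<bar>
          \<le> \<P>(\<omega> in M. bad m (N \<omega>))"
      proof (rule prob_space.prob_diff_le_prob_differ[OF prob])
        show "Measurable.pred M (\<lambda>\<omega>. X (N \<omega>))" "Measurable.pred M (\<lambda>\<omega>. Q m (occupied m R (N \<omega>)))"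
          unfolding X_def Q_def
          using B L fin by (intro pred_counts pred_occupied_counts pp; simp)+
        show "Measurable.pred M (\<lambda>\<omega>. bad m (N \<omega>))"
          unfolding bad_def by (intro pred_bad pp fin)
      qed (use X_eq point_process_in_pt_measures[OF pp] in blast)
      then have "\<bar>p * \<P>(\<omega> in M. X (N \<omega>)) - p * \<P>(\<omega> in M. Q m (occupied m R (N \<omega>)))\<bar> \<le> e"
        using bad mult_mono[OF p, of "\<bar>\<P>(\<omega> in M. X (N \<omega>)) - \<P>(\<omega> in M. Q m (occupied m R (N \<omega>)))\<bar>" e]
        by (simp add: right_diff_distrib[symmetric] abs_mult)
      ultimately show ?case using elim by (simp add: dist_real_def)
    qed
  qed
  have "(\<lambda>n. \<P>(\<omega> in Mn n. A n \<omega> \<and> X (Nn n \<omega>))) \<longlonglongrightarrow> p * \<P>(\<omega> in M. X (N \<omega>))"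
  proof (rule tendstoI)
    fix e :: real assume "0 < e"
    then show "eventually (\<lambda>n. dist \<P>(\<omega> in Mn n. A n \<omega> \<and> X (Nn n \<omega>)) (p * \<P>(\<omega> in M. X (N \<omega>))) < e) sequentially"
      using eps[of "e / 3"] by (simp add: dist_real_def)
  qed
  then show ?thesis by (simp only: X_def)
qed

end

section \<open>Cell counts and the vague topology\<close>

text \<open>The window grows with the level, so that the counts of all levels together determine a locally
  finite measure.\<close>

definition cell_counts :: "nat \<Rightarrow> real measure \<Rightarrow> int \<Rightarrow> ennreal" where
  "cell_counts m \<mu> = restrict (\<lambda>j. emeasure \<mu> (cell m j)) (window m m)"

definition count_vectors :: "nat \<Rightarrow> (int \<Rightarrow> ennreal) set" where
  "count_vectors m = Pi\<^sub>E (window m m) (\<lambda>_. range of_nat)"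

lemma countable_count_vectors: "countable (count_vectors m)"
  unfolding count_vectors_def by (intro countable_PiE) auto

lemma cell_counts_in_count_vectors:
  assumes "\<mu> \<in> pt_measures"
  shows "cell_counts m \<mu> \<in> count_vectors m"
  unfolding count_vectors_def cell_counts_def
proof (rule restrict_PiE_iff[THEN iffD2], rule ballI)
  fix j
  obtain k :: nat where "emeasure \<mu> (cell m j) = of_nat k"
    using pt_measures_count[OF assms cell_borel bounded_cell] .
  then show "emeasure \<mu> (cell m j) \<in> range of_nat" by simp
qed

lemma cell_counts_eq_iff:
  assumes "v \<in> count_vectors m"
  shows "cell_counts m \<mu> = v \<longleftrightarrow> (\<forall>j\<in>window m m. emeasure \<mu> (cell m j) \<in> {v j})"
proof -
  have v: "v \<in> extensional (window m m)"
    using assms by (simp add: count_vectors_def PiE_def)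
  show ?thesis
  proof
    assume eq: "cell_counts m \<mu> = v"
    show "\<forall>j\<in>window m m. emeasure \<mu> (cell m j) \<in> {v j}"
    proof
      fix j assume "j \<in> window m m"
      with fun_cong[OF eq, of j] show "emeasure \<mu> (cell m j) \<in> {v j}" by (simp add: cell_counts_def)
    qed
  next
    assume "\<forall>j\<in>window m m. emeasure \<mu> (cell m j) \<in> {v j}"
    then show "cell_counts m \<mu> = v"
      unfolding cell_counts_def by (intro extensionalityI[OF restrict_extensional v]) simp
  qed
qed

text \<open>The integral is compared with that of the step function with value \<open>h j\<close> on the \<open>j\<close>th cell.\<close>

lemma integral_approx_by_cell_sum:
  fixes f :: "real \<Rightarrow> real"
  assumes \<mu>: "\<mu> \<in> pt_measures" and f [measurable]: "f \<in> borel_measurable borel"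
    and supp: "\<And>x. x \<notin> {- real R <.. real R} \<Longrightarrow> f x = 0"
    and close: "\<And>j x. j \<in> window m R \<Longrightarrow> x \<in> cell m j \<Longrightarrow> \<bar>f x - h j\<bar> \<le> \<eta>"
  shows "\<bar>(\<integral>x. f x \<partial>\<mu>) - (\<Sum>j\<in>window m R. h j * measure \<mu> (cell m j))\<bar>
    \<le> \<eta> * measure \<mu> {- real R <.. real R}"
proof -
  let ?W = "{- real R <.. real R}"
  note [simp, measurable_cong] = pt_measures_sets[OF \<mu>]
  have [simp]: "space \<mu> = UNIV" using \<mu> by (rule pt_measures_space)
  have fin: "emeasure \<mu> B < \<infinity>" if "B \<in> sets borel" "bounded B" for B
    using \<mu> that by (auto simp: pt_measures_def)
  have int_ind: "integrable \<mu> (indicator B :: real \<Rightarrow> real)" if "B \<in> sets borel" "bounded B" for B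
    using fin[OF that] that by (intro integrable_real_indicator) auto
  define g where "g x = (\<Sum>j\<in>window m R. h j * indicator (cell m j) x)" for x :: real
  have g_int: "integrable \<mu> g"
    unfolding g_def by (intro Bochner_Integration.integrable_sum integrable_mult_right int_ind)
      (auto simp: bounded_cell)
  have g_integral: "(\<integral>x. g x \<partial>\<mu>) = (\<Sum>j\<in>window m R. h j * measure \<mu> (cell m j))"
    unfolding g_def
    by (subst Bochner_Integration.integral_sum)
       (auto intro!: integrable_mult_right int_ind simp: bounded_cell)
  have W_int: "integrable \<mu> (\<lambda>x. \<eta> * indicator ?W x :: real)"
    by (intro integrable_mult_right int_ind) auto
  have bound: "\<bar>f x - g x\<bar> \<le> \<eta> * indicator ?W x" for x
  proof (cases "x \<in> ?W")
    case True
    then obtain i where i: "i \<in> window m R" "x \<in> cell m i" using Union_cells[of m R] by blast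
    have "g x = (\<Sum>j\<in>window m R. if j = i then h j else 0)"
      unfolding g_def using i(2) by (intro sum.cong) (auto simp: mem_cell_iff indicator_def)
    also have "\<dots> = h i" using i(1) by simp
    finally show ?thesis using close[OF i] True by simp
  next
    case False
    then have "indicator (cell m j) x = (0::real)" if "j \<in> window m R" for j
      using cell_subset_window[OF that] by (auto simp: indicator_def)
    then have "g x = 0" by (auto simp: g_def)
    with supp[OF False] False show ?thesis by simp
  qed
  have f_int: "integrable \<mu> f"
  proof (rule Bochner_Integration.integrable_bound)
    show "integrable \<mu> (\<lambda>x. \<bar>g x\<bar> + \<eta> * indicator ?W x)"
      by (intro Bochner_Integration.integrable_add integrable_abs g_int W_int)
    show "AE x in \<mu>. norm (f x) \<le> norm (\<bar>g x\<bar> + \<eta> * indicator ?W x)"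
    proof (rule AE_I2)
      fix x show "norm (f x) \<le> norm (\<bar>g x\<bar> + \<eta> * indicator ?W x)"
        using bound[of x] unfolding real_norm_def by linarith
    qed
  qed measurable
  have "\<bar>(\<integral>x. f x \<partial>\<mu>) - (\<integral>x. g x \<partial>\<mu>)\<bar> = \<bar>\<integral>x. f x - g x \<partial>\<mu>\<bar>"
    by (simp add: Bochner_Integration.integral_diff f_int g_int)
  also have "\<dots> \<le> (\<integral>x. \<bar>f x - g x\<bar> \<partial>\<mu>)" by (rule integral_abs_bound)
  also have "\<dots> \<le> (\<integral>x. \<eta> * indicator ?W x \<partial>\<mu>)"
    by (intro integral_mono bound W_int integrable_abs Bochner_Integration.integrable_diff f_int g_int)
  also have "\<dots> = \<eta> * measure \<mu> ?W" by simp
  finally show ?thesis unfolding g_integral .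
qed

text \<open>The step function takes its values from \<open>f\<close>, and both measures integrate it to the same number.
  The window is fixed by the support of \<open>f\<close> before the level is chosen, so the error is uniform over
  all \<open>\<nu>\<close> with the same counts. The measure \<open>\<mu>\<close> may charge endpoints of cells: a vague neighbourhood
  contains a class of equal counts around \<open>\<mu>\<close>, which need not be open.\<close>

lemma eventually_integral_close_if_same_cell_counts:
  fixes f :: "real \<Rightarrow> real"
  assumes cont: "continuous_on UNIV f" and comp: "compact (closure {x. f x \<noteq> 0})"
    and \<mu>: "\<mu> \<in> pt_measures" and e: "0 < e"
  shows "eventually (\<lambda>m. \<forall>\<nu>\<in>pt_measures. cell_counts m \<nu> = cell_counts m \<mu> \<longrightarrow>
    \<bar>(\<integral>x. f x \<partial>\<nu>) - (\<integral>x. f x \<partial>\<mu>)\<bar> < e) sequentially"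
proof -
  obtain r where r: "\<And>x. f x \<noteq> 0 \<Longrightarrow> \<bar>x\<bar> \<le> r"
    using compact_imp_bounded[OF comp] closure_subset[of "{x. f x \<noteq> 0}"] by (auto simp: bounded_iff)
  obtain R :: nat where "r < real R" using reals_Archimedean2 by blast
  with r have supp: "f x = 0" if "x \<notin> {- real R <.. real R}" for x using that by force
  have f: "f \<in> borel_measurable borel" using cont by (rule borel_measurable_continuous_onI)
  define c where "c = measure \<mu> {- real R <.. real R}"
  \<comment> \<open>Each of the two integrals is off by at most \<open>\<eta> * c\<close>; adding one avoids a division by zero.\<close>
  define \<eta> where "\<eta> = e / (2 * (c + 1))"
  have c: "0 \<le> c" by (simp add: c_def)
  then have "0 < \<eta>" using e by (simp add: \<eta>_def)
  have "\<eta> * (2 * (c + 1)) = e" using c by (simp add: \<eta>_def)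
  then have \<eta>: "\<eta> * c + \<eta> * c < e" using \<open>0 < \<eta>\<close> by (simp add: algebra_simps)
  have "uniformly_continuous_on {- real R .. real R} f"
    using continuous_on_subset[OF cont] by (intro compact_uniformly_continuous) auto
  then obtain d where d: "0 < d"
    "\<And>x y. x \<in> {- real R .. real R} \<Longrightarrow> y \<in> {- real R .. real R} \<Longrightarrow> dist y x < d \<Longrightarrow> dist (f y) (f x) < \<eta>"
    using \<open>0 < \<eta>\<close> unfolding uniformly_continuous_on_def by metis
  from eventually_dyadic_less[OF d(1)] eventually_ge_at_top[of R] show ?thesis
  proof eventually_elim
    case (elim m)
    define h where "h j = f (SOME x. x \<in> cell m j)" for j
    have close: "\<bar>f x - h j\<bar> \<le> \<eta>" if j: "j \<in> window m R" and x: "x \<in> cell m j" for j x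
    proof -
      define y where "y = (SOME x. x \<in> cell m j)"
      have y: "y \<in> cell m j" unfolding y_def using x by (rule someI)
      have "dist x y < d" using dist_cell[OF x y] elim(1) by simp
      then have "dist (f x) (f y) < \<eta>"
        using cell_subset_window[OF j] x y by (intro d(2)) auto
      then show ?thesis by (simp add: h_def y_def dist_real_def)
    qed
    show ?case
    proof (intro ballI impI)
      fix \<nu> assume \<nu>: "\<nu> \<in> pt_measures" and same: "cell_counts m \<nu> = cell_counts m \<mu>"
      have cells: "emeasure \<nu> (cell m j) = emeasure \<mu> (cell m j)" if "j \<in> window m R" for j
      proof -
        have "j \<in> window m m" using that window_mono[OF elim(2)] by blast
        with fun_cong[OF same, of j] show ?thesis by (simp add: cell_counts_def)
      qed
      then have "emeasure \<nu> {- real R <.. real R} = emeasure \<mu> {- real R <.. real R}"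
        unfolding emeasure_window[OF \<mu>, of R m] emeasure_window[OF \<nu>, of R m] by (rule sum.cong[OF refl])
      then have W: "measure \<nu> {- real R <.. real R} = c" by (simp add: c_def measure_def)
      have S: "(\<Sum>j\<in>window m R. h j * measure \<nu> (cell m j)) = (\<Sum>j\<in>window m R. h j * measure \<mu> (cell m j))"
        using cells by (intro sum.cong) (auto simp: measure_def)
      show "\<bar>(\<integral>x. f x \<partial>\<nu>) - (\<integral>x. f x \<partial>\<mu>)\<bar> < e"
        using integral_approx_by_cell_sum[where h = h and m = m and R = R, OF \<nu> f supp close]
          integral_approx_by_cell_sum[where h = h and m = m and R = R, OF \<mu> f supp close] \<eta>
        unfolding W S c_def[symmetric] by linarith
    qed
  qed
qed

lemma eventually_same_cell_counts_in_open:
  assumes "openin vague_topology G" "\<mu> \<in> G" "\<mu> \<in> pt_measures"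
  shows "eventually (\<lambda>m. \<forall>\<nu>\<in>pt_measures. cell_counts m \<nu> = cell_counts m \<mu> \<longrightarrow> \<nu> \<in> G) sequentially"
  using assms(1)[unfolded vague_topology_def openin_topology_generated_by_iff] assms(2)
proof (induction rule: generate_topology_on.induct)
  case (Int a b)
  then have "eventually (\<lambda>m. \<forall>\<nu>\<in>pt_measures. cell_counts m \<nu> = cell_counts m \<mu> \<longrightarrow> \<nu> \<in> a) sequentially"
    "eventually (\<lambda>m. \<forall>\<nu>\<in>pt_measures. cell_counts m \<nu> = cell_counts m \<mu> \<longrightarrow> \<nu> \<in> b) sequentially"
    by blast+
  then show ?case by eventually_elim blast
next
  case (UN K)
  then obtain k where "k \<in> K" "\<mu> \<in> k" by blast
  with UN(2)[OF this] show ?case by (auto elim!: eventually_mono)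
next
  case (Basis s)
  then obtain f :: "real \<Rightarrow> real" and V where s: "s = {\<mu> \<in> pt_measures. (\<integral>x. f x \<partial>\<mu>) \<in> V}"
    and f: "continuous_on UNIV f" "compact (closure {x. f x \<noteq> 0})" and V: "open V"
    by auto
  have "(\<integral>x. f x \<partial>\<mu>) \<in> V" using Basis(2) s by simp
  with V obtain e where e: "0 < e" "ball (\<integral>x. f x \<partial>\<mu>) e \<subseteq> V" by (auto simp: open_contains_ball)
  from eventually_integral_close_if_same_cell_counts[OF f assms(3) e(1)] show ?case
  proof eventually_elim
    case (elim m)
    with e(2) show ?case by (force simp: s dist_real_def)
  qed
qed simp

lemma topspace_vague: "topspace vague_topology = pt_measures"
proof -
  let ?S = "{{\<mu> \<in> pt_measures. (\<integral>x. f x \<partial>\<mu>) \<in> V} | (f :: real \<Rightarrow> real) V.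
        continuous_on UNIV f \<and> compact (closure {x. f x \<noteq> 0}) \<and> open V}"
  have "{\<mu> \<in> pt_measures. (\<integral>x. (0::real) \<partial>\<mu>) \<in> UNIV} \<in> ?S"
    by (intro CollectI exI[of _ "\<lambda>_. 0"] exI[of _ UNIV]) auto
  then have "pt_measures \<in> ?S" by simp
  then have "\<Union>?S = pt_measures" by blast
  then show ?thesis by (simp add: vague_topology_def)
qed

text \<open>Taken in the extended nonnegative reals, so that a vector of counts that no measure realises has
  the harmless value \<open>\<infinity>\<close>.\<close>

definition class_inf :: "nat \<Rightarrow> (real measure \<Rightarrow> real) \<Rightarrow> (int \<Rightarrow> ennreal) \<Rightarrow> ennreal" where
  "class_inf m F v = (INF \<nu>\<in>{\<nu> \<in> pt_measures. cell_counts m \<nu> = v}. ennreal (F \<nu>))"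

lemma class_inf_le: "\<mu> \<in> pt_measures \<Longrightarrow> class_inf m F (cell_counts m \<mu>) \<le> ennreal (F \<mu>)"
  unfolding class_inf_def by (intro INF_lower) simp

text \<open>Classes of equal counts eventually fit into the open set where \<open>F\<close> exceeds a given value below
  \<open>F \<mu>\<close>.\<close>

lemma class_inf_tendsto:
  assumes F: "continuous_map vague_topology euclideanreal F" and \<mu>: "\<mu> \<in> pt_measures"
    and pos: "0 \<le> F \<mu>"
  shows "(\<lambda>m. class_inf m F (cell_counts m \<mu>)) \<longlonglongrightarrow> ennreal (F \<mu>)"
proof (rule order_tendstoI)
  fix a assume "a < ennreal (F \<mu>)"
  then obtain b where b: "a < b" "b < ennreal (F \<mu>)" using dense by blast
  then obtain b' where b': "b = ennreal b'" "0 \<le> b'" by (cases b) auto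
  with b(2) have "b' < F \<mu>" by (simp add: ennreal_less_iff)
  have "openin vague_topology {\<nu> \<in> topspace vague_topology. F \<nu> \<in> {b'<..}}"
    by (rule openin_continuous_map_preimage[OF F]) simp
  from eventually_same_cell_counts_in_open[OF this _ \<mu>]
  have "eventually (\<lambda>m. \<forall>\<nu>\<in>pt_measures. cell_counts m \<nu> = cell_counts m \<mu> \<longrightarrow> b' < F \<nu>) sequentially"
    using \<mu> \<open>b' < F \<mu>\<close> by (simp add: topspace_vague)
  then show "eventually (\<lambda>m. a < class_inf m F (cell_counts m \<mu>)) sequentially"
  proof eventually_elim
    case (elim m)
    then have "b \<le> class_inf m F (cell_counts m \<mu>)"
      unfolding class_inf_def b' by (intro INF_greatest ennreal_leI) (auto intro: less_imp_le)
    with b(1) show ?case by (rule less_le_trans)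
  qed
next
  fix a assume "ennreal (F \<mu>) < a"
  then show "eventually (\<lambda>m. class_inf m F (cell_counts m \<mu>) < a) sequentially"
    by (intro always_eventually allI le_less_trans[OF class_inf_le[OF \<mu>]])
qed

section \<open>Weak convergence from cell counts\<close>

lemma cell_counts_measurable:
  assumes pp: "point_process M N"
  shows "(\<lambda>\<omega>. cell_counts m (N \<omega>)) \<in> measurable M (count_space (count_vectors m))"
proof (subst measurable_count_space_eq_countable[OF countable_count_vectors], intro conjI ballI)
  show "(\<lambda>\<omega>. cell_counts m (N \<omega>)) \<in> space M \<rightarrow> count_vectors m"
    using cell_counts_in_count_vectors point_process_in_pt_measures[OF pp] by blast
  fix v assume v: "v \<in> count_vectors m"
  have "Measurable.pred M (\<lambda>\<omega>. \<forall>j\<in>window m m. emeasure (N \<omega>) (cell m j) \<in> {v j})"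
    by (intro pred_counts pp) auto
  moreover have "(\<lambda>\<omega>. cell_counts m (N \<omega>)) -` {v} \<inter> space M =
      {\<omega> \<in> space M. \<forall>j\<in>window m m. emeasure (N \<omega>) (cell m j) \<in> {v j}}"
    using cell_counts_eq_iff[OF v] by auto
  ultimately show "(\<lambda>\<omega>. cell_counts m (N \<omega>)) -` {v} \<inter> space M \<in> sets M"
    by (simp add: pred_def)
qed

lemma measurable_comp_cell_counts:
  assumes pp: "point_process M N"
  shows "(\<lambda>\<omega>. g (cell_counts m (N \<omega>)) :: ennreal) \<in> borel_measurable M"
  by (rule measurable_compose[OF cell_counts_measurable[OF pp]]) simp

text \<open>The vector of counts is a discrete random variable.\<close>

lemma nn_integral_comp_cell_counts:
  fixes g :: "_ \<Rightarrow> ennreal"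
  assumes pp: "point_process M N"
  shows "(\<integral>\<^sup>+\<omega>. g (cell_counts m (N \<omega>)) \<partial>M) =
    (\<integral>\<^sup>+v. g v * ennreal (\<P>(\<omega> in M. cell_counts m (N \<omega>) = v)) \<partial>count_space (count_vectors m))"
proof -
  interpret prob_space M using pp by (rule point_process_prob_space)
  have sets: "{\<omega> \<in> space M. cell_counts m (N \<omega>) = v} \<in> sets M" if "v \<in> count_vectors m" for v
  proof -
    have "(\<lambda>\<omega>. cell_counts m (N \<omega>)) -` {v} \<inter> space M \<in> sets M"
      using that by (intro measurable_sets[OF cell_counts_measurable[OF pp]]) auto
    also have "(\<lambda>\<omega>. cell_counts m (N \<omega>)) -` {v} \<inter> space M = {\<omega> \<in> space M. cell_counts m (N \<omega>) = v}"
      by auto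
    finally show ?thesis .
  qed
  let ?I = "\<lambda>v. indicator {\<omega> \<in> space M. cell_counts m (N \<omega>) = v} :: _ \<Rightarrow> ennreal"
  have "(\<integral>\<^sup>+\<omega>. g (cell_counts m (N \<omega>)) \<partial>M) =
      (\<integral>\<^sup>+\<omega>. \<integral>\<^sup>+v. g v * ?I v \<omega> \<partial>count_space (count_vectors m) \<partial>M)"
  proof (rule nn_integral_cong)
    fix \<omega> assume \<omega>: "\<omega> \<in> space M"
    let ?v = "cell_counts m (N \<omega>)"
    have v: "?v \<in> count_vectors m"
      using cell_counts_in_count_vectors[OF point_process_in_pt_measures[OF pp \<omega>]] .
    have "(\<integral>\<^sup>+v. g v * ?I v \<omega> \<partial>count_space (count_vectors m)) =
        (\<integral>\<^sup>+v. g v * indicator {?v} v \<partial>count_space (count_vectors m))"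
      using \<omega> by (intro nn_integral_cong) (auto simp: indicator_def)
    also have "\<dots> = g ?v" using v by simp
    finally show "g ?v = (\<integral>\<^sup>+v. g v * ?I v \<omega> \<partial>count_space (count_vectors m))" by simp
  qed
  also have "\<dots> = (\<integral>\<^sup>+v. \<integral>\<^sup>+\<omega>. g v * ?I v \<omega> \<partial>M \<partial>count_space (count_vectors m))"
    using sets by (intro nn_integral_count_space_nn_integral countable_count_vectors) auto
  also have "\<dots> = (\<integral>\<^sup>+v. g v * ennreal (\<P>(\<omega> in M. cell_counts m (N \<omega>) = v)) \<partial>count_space (count_vectors m))"
    using sets by (intro nn_integral_cong) (simp add: nn_integral_cmult emeasure_eq_measure)
  finally show ?thesis .
qed

text \<open>A vaguely continuous functional is a pointwise limit of functions of the counts in finitely many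
  cells.\<close>

lemma vague_continuous_measurable:
  assumes pp: "point_process M N" and F: "continuous_map vague_topology euclideanreal F"
    and pos: "\<And>\<mu>. \<mu> \<in> pt_measures \<Longrightarrow> 0 \<le> F \<mu>"
  shows "(\<lambda>\<omega>. F (N \<omega>)) \<in> borel_measurable M"
proof -
  have "(\<lambda>\<omega>. ennreal (F (N \<omega>))) \<in> borel_measurable M"
  proof (rule borel_measurable_LIMSEQ_order)
    show "(\<lambda>m. class_inf m F (cell_counts m (N \<omega>))) \<longlonglongrightarrow> ennreal (F (N \<omega>))" if "\<omega> \<in> space M" for \<omega>
      using point_process_in_pt_measures[OF pp that] by (intro class_inf_tendsto F pos)
  qed (rule measurable_comp_cell_counts[OF pp])
  then have "(\<lambda>\<omega>. enn2real (ennreal (F (N \<omega>)))) \<in> borel_measurable M" by measurable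
  also have "?this \<longleftrightarrow> ?thesis"
    using point_process_in_pt_measures[OF pp] pos by (intro measurable_cong) simp
  finally show ?thesis .
qed

lemma vague_continuous_expectation_shift:
  assumes X: "point_process K X" and F: "continuous_map vague_topology euclideanreal F"
    and bdd: "\<And>\<mu>. \<mu> \<in> pt_measures \<Longrightarrow> \<bar>F \<mu>\<bar> \<le> C"
  shows "(\<integral>\<^sup>+\<omega>. ennreal (F (X \<omega>) + C) \<partial>K) = ennreal ((\<integral>\<omega>. F (X \<omega>) \<partial>K) + C)"
    and "0 \<le> (\<integral>\<omega>. F (X \<omega>) \<partial>K) + C"
proof -
  interpret prob_space K using X by (rule point_process_prob_space)
  have FC: "continuous_map vague_topology euclideanreal (\<lambda>\<mu>. F \<mu> + C)"
    by (intro continuous_map_add F) simp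
  have pos: "0 \<le> F \<mu> + C" if "\<mu> \<in> pt_measures" for \<mu>
    using bdd[OF that] by linarith
  have "(\<lambda>\<omega>. F (X \<omega>) + C) \<in> borel_measurable K"
    by (rule vague_continuous_measurable[OF X FC pos])
  then have "(\<lambda>\<omega>. (F (X \<omega>) + C) - C) \<in> borel_measurable K" by measurable
  then have meas: "(\<lambda>\<omega>. F (X \<omega>)) \<in> borel_measurable K" by simp
  have int: "integrable K (\<lambda>\<omega>. F (X \<omega>))"
    using bdd point_process_in_pt_measures[OF X] meas
    by (intro integrable_const_bound[where B = C]) (auto intro!: AE_I2)
  have *: "(\<integral>\<omega>. F (X \<omega>) + C \<partial>K) = (\<integral>\<omega>. F (X \<omega>) \<partial>K) + C"
    using int by (simp add: prob_space)
  have nonneg: "0 \<le> F (X \<omega>) + C" if "\<omega> \<in> space K" for \<omega>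
    using pos point_process_in_pt_measures[OF X that] by blast
  show "(\<integral>\<^sup>+\<omega>. ennreal (F (X \<omega>) + C) \<partial>K) = ennreal ((\<integral>\<omega>. F (X \<omega>) \<partial>K) + C)"
    unfolding *[symmetric] using int nonneg by (intro nn_integral_eq_integral AE_I2) auto
  show "0 \<le> (\<integral>\<omega>. F (X \<omega>) \<partial>K) + C"
    unfolding *[symmetric] using nonneg by (intro Bochner_Integration.integral_nonneg) auto
qed

context avoidance_and_intensity_convergence
begin

lemma cell_counts_convergence:
  assumes v: "v \<in> count_vectors m"
  shows "(\<lambda>n. \<P>(\<omega> in Mn n. cell_counts m (Nn n \<omega>) = v)) \<longlonglongrightarrow> \<P>(\<omega> in M. cell_counts m (N \<omega>) = v)"
proof -
  have "(\<lambda>m'. \<P>(\<omega> in M. emeasure (N \<omega>) (straddling m' R (cell m j)) \<noteq> 0)) \<longlonglongrightarrow> 0" for R j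
  proof (rule tendsto_eventually)
    show "eventually (\<lambda>m'. \<P>(\<omega> in M. emeasure (N \<omega>) (straddling m' R (cell m j)) \<noteq> 0) = 0) sequentially"
      using eventually_ge_at_top[of m] by eventually_elim (simp add: straddling_cell)
  qed
  then have "(\<lambda>n. \<P>(\<omega> in Mn n. True \<and> (\<forall>j\<in>window m m. emeasure (Nn n \<omega>) (cell m j) \<in> {v j})))
      \<longlonglongrightarrow> 1 * \<P>(\<omega> in M. \<forall>j\<in>window m m. emeasure (N \<omega>) (cell m j) \<in> {v j})"
    by (intro count_convergence) (use avoidance in \<open>simp_all add: bounded_cell\<close>)
  then show ?thesis unfolding cell_counts_eq_iff[OF v] by simp
qed

text \<open>The functionals \<open>class_inf m F\<close> lie below \<open>F\<close> and depend on finitely many counts only. Since these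
  converge in law on a countable set, Fatou's lemma for the counting measure compares the
  expectations at each level \<open>m\<close>. A second use of Fatou's lemma lets \<open>m\<close> tend to infinity.\<close>

lemma nn_integral_vague_continuous_le_liminf:
  assumes F: "continuous_map vague_topology euclideanreal F"
    and pos: "\<And>\<mu>. \<mu> \<in> pt_measures \<Longrightarrow> 0 \<le> F \<mu>"
  shows "(\<integral>\<^sup>+\<omega>. ennreal (F (N \<omega>)) \<partial>M) \<le> liminf (\<lambda>n. \<integral>\<^sup>+\<omega>. ennreal (F (Nn n \<omega>)) \<partial>Mn n)" (is "_ \<le> ?L")
proof -
  let ?g = "\<lambda>m \<mu>. class_inf m F (cell_counts m \<mu>)"
  have level: "(\<integral>\<^sup>+\<omega>. ?g m (N \<omega>) \<partial>M) \<le> ?L" for m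
  proof -
    let ?C = "count_space (count_vectors m)"
    have "(\<integral>\<^sup>+\<omega>. ?g m (N \<omega>) \<partial>M) =
        (\<integral>\<^sup>+v. class_inf m F v * ennreal (\<P>(\<omega> in M. cell_counts m (N \<omega>) = v)) \<partial>?C)"
      by (rule nn_integral_comp_cell_counts[OF pp])
    also have "\<dots> \<le> (\<integral>\<^sup>+v. liminf (\<lambda>n. class_inf m F v * ennreal (\<P>(\<omega> in Mn n. cell_counts m (Nn n \<omega>) = v))) \<partial>?C)"
    proof (rule nn_integral_mono)
      fix v assume "v \<in> space ?C"
      then have lim: "(\<lambda>n. ennreal (\<P>(\<omega> in Mn n. cell_counts m (Nn n \<omega>) = v))) \<longlonglongrightarrow>
          ennreal (\<P>(\<omega> in M. cell_counts m (N \<omega>) = v))"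
        by (intro tendsto_ennrealI cell_counts_convergence) simp
      show "class_inf m F v * ennreal (\<P>(\<omega> in M. cell_counts m (N \<omega>) = v)) \<le>
          liminf (\<lambda>n. class_inf m F v * ennreal (\<P>(\<omega> in Mn n. cell_counts m (Nn n \<omega>) = v)))"
      \<comment> \<open>The infimum may be infinite, and multiplication by \<open>\<infinity>\<close> is discontinuous at \<open>0\<close>.\<close>
      proof (cases "\<P>(\<omega> in M. cell_counts m (N \<omega>) = v) = 0")
        case False
        then have "(\<lambda>n. class_inf m F v * ennreal (\<P>(\<omega> in Mn n. cell_counts m (Nn n \<omega>) = v))) \<longlonglongrightarrow>
            class_inf m F v * ennreal (\<P>(\<omega> in M. cell_counts m (N \<omega>) = v))"
          by (intro tendsto_mult_ennreal tendsto_const lim) (simp add: ennreal_eq_0_iff measure_le_0_iff)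
        then show ?thesis by (simp add: lim_imp_Liminf)
      qed simp
    qed
    also have "\<dots> \<le> liminf (\<lambda>n. \<integral>\<^sup>+v. class_inf m F v * ennreal (\<P>(\<omega> in Mn n. cell_counts m (Nn n \<omega>) = v)) \<partial>?C)"
      by (rule nn_integral_liminf) simp
    also have "\<dots> = liminf (\<lambda>n. \<integral>\<^sup>+\<omega>. ?g m (Nn n \<omega>) \<partial>Mn n)"
      by (simp only: nn_integral_comp_cell_counts[OF pp_n])
    also have "\<dots> \<le> ?L"
      by (intro Liminf_mono always_eventually allI nn_integral_mono class_inf_le
          point_process_in_pt_measures[OF pp_n])
    finally show ?thesis .
  qed
  have "(\<integral>\<^sup>+\<omega>. ennreal (F (N \<omega>)) \<partial>M) = (\<integral>\<^sup>+\<omega>. liminf (\<lambda>m. ?g m (N \<omega>)) \<partial>M)"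
  proof (rule nn_integral_cong)
    fix \<omega> assume "\<omega> \<in> space M"
    then have "(\<lambda>m. ?g m (N \<omega>)) \<longlonglongrightarrow> ennreal (F (N \<omega>))"
      using point_process_in_pt_measures[OF pp] by (intro class_inf_tendsto F pos)
    then show "ennreal (F (N \<omega>)) = liminf (\<lambda>m. ?g m (N \<omega>))"
      by (intro lim_imp_Liminf[symmetric]) auto
  qed
  also have "\<dots> \<le> liminf (\<lambda>m. \<integral>\<^sup>+\<omega>. ?g m (N \<omega>) \<partial>M)"
    by (intro nn_integral_liminf measurable_comp_cell_counts[OF pp])
  also have "\<dots> \<le> liminf (\<lambda>m::nat. ?L)"
    by (intro Liminf_mono always_eventually allI level)
  also have "\<dots> = ?L" by (rule Liminf_const) simp
  finally show ?thesis .
qed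

text \<open>Adding the bound \<open>C\<close> makes the functional nonnegative; applied to \<open>F\<close> and to \<open>- F\<close>, this gives
  convergence of the expectations.\<close>

lemma integral_vague_continuous_lower:
  assumes F: "continuous_map vague_topology euclideanreal F"
    and bdd: "\<And>\<mu>. \<mu> \<in> pt_measures \<Longrightarrow> \<bar>F \<mu>\<bar> \<le> C"
    and c: "c < (\<integral>\<omega>. F (N \<omega>) \<partial>M)"
  shows "eventually (\<lambda>n. c < (\<integral>\<omega>. F (Nn n \<omega>) \<partial>Mn n)) sequentially"
proof -
  have FC: "continuous_map vague_topology euclideanreal (\<lambda>\<mu>. F \<mu> + C)"
    by (intro continuous_map_add F) simp
  have pos: "0 \<le> F \<mu> + C" if "\<mu> \<in> pt_measures" for \<mu>
    using bdd[OF that] by linarith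
  note shift = vague_continuous_expectation_shift[OF _ F bdd]
  show ?thesis
  proof (cases "0 \<le> c + C")
    case False
    have "c < (\<integral>\<omega>. F (Nn n \<omega>) \<partial>Mn n)" for n
      using shift(2)[OF pp_n, of n] False by linarith
    then show ?thesis by simp
  next
    case True
    then have "ennreal (c + C) < ennreal ((\<integral>\<omega>. F (N \<omega>) \<partial>M) + C)"
      using c by (intro ennreal_lessI) auto
    also have "\<dots> \<le> liminf (\<lambda>n. ennreal ((\<integral>\<omega>. F (Nn n \<omega>) \<partial>Mn n) + C))"
      using nn_integral_vague_continuous_le_liminf[OF FC pos]
      by (simp only: shift(1)[OF pp] shift(1)[OF pp_n])
    finally have "eventually (\<lambda>n. ennreal (c + C) < ennreal ((\<integral>\<omega>. F (Nn n \<omega>) \<partial>Mn n) + C)) sequentially"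
      by (rule less_LiminfD)
    then show ?thesis by eventually_elim (simp add: ennreal_less_iff[OF True])
  qed
qed

lemma vague_convergence: "pp_converges_in_distribution Mn Nn M N"
  unfolding pp_converges_in_distribution_def
proof (intro allI impI)
  fix F assume "continuous_map vague_topology euclideanreal F \<and> bounded (F ` pt_measures)"
  then obtain C where F: "continuous_map vague_topology euclideanreal F"
    and C: "\<And>\<mu>. \<mu> \<in> pt_measures \<Longrightarrow> \<bar>F \<mu>\<bar> \<le> C"
    by (auto simp: bounded_iff)
  have F': "continuous_map vague_topology euclideanreal (\<lambda>\<mu>. - F \<mu>)"
    by (intro continuous_map_minus F)
  show "(\<lambda>n. \<integral>\<omega>. F (Nn n \<omega>) \<partial>Mn n) \<longlonglongrightarrow> (\<integral>\<omega>. F (N \<omega>) \<partial>M)"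
  proof (rule order_tendstoI)
    fix a assume "(\<integral>\<omega>. F (N \<omega>) \<partial>M) < a"
    then have "- a < (\<integral>\<omega>. - F (N \<omega>) \<partial>M)" by simp
    from integral_vague_continuous_lower[OF F' _ this, of C] C
    show "eventually (\<lambda>n. (\<integral>\<omega>. F (Nn n \<omega>) \<partial>Mn n) < a) sequentially" by simp
  qed (rule integral_vague_continuous_lower[OF F C])
qed

end

section \<open>Asymptotic independence\<close>

lemma continuity_set_straddling_tendsto_0:
  assumes pp: "point_process M N" and B: "B \<in> continuity_sets M N"
  shows "(\<lambda>m. \<P>(\<omega> in M. emeasure (N \<omega>) (straddling m R B) \<noteq> 0)) \<longlonglongrightarrow> 0"
proof (rule prob_tendsto_0_if_AE_eventually_not)
  note [measurable] = measurable_point_count[OF pp]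
  show "Measurable.pred M (\<lambda>\<omega>. emeasure (N \<omega>) (straddling m R B) \<noteq> 0)" for m
    by measurable
  have "bounded B" and null: "AE \<omega> in M. emeasure (N \<omega>) (frontier B) = 0"
    using B by (auto simp: continuity_sets_def)
  from null AE_space
  show "AE \<omega> in M. eventually (\<lambda>m. \<not> emeasure (N \<omega>) (straddling m R B) \<noteq> 0) sequentially"
  proof eventually_elim
    case (elim \<omega>)
    then show ?case
      using eventually_straddling_null[OF point_process_in_pt_measures[OF pp] \<open>bounded B\<close>] by simp
  qed
qed (rule point_process_prob_space[OF pp])

text \<open>Large values of the marks are rare for \<open>Y\<close>, and taking \<open>U\<close> empty in the joint convergence shows
  that they are asymptotically just as rare for \<open>Yn n\<close>. So the restriction \<open>Yn n \<omega> \<le> y\<close> can be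
  dropped by choosing \<open>y\<close> large.\<close>

lemma avoidance_without_marks:
  fixes Y :: "'b \<Rightarrow> real" and Yn :: "nat \<Rightarrow> 'a \<Rightarrow> real"
  assumes pp_n: "\<And>n. point_process (Mn n) (Nn n)" and pp: "point_process M N"
    and Yn: "\<And>n. Yn n \<in> borel_measurable (Mn n)" and Y: "Y \<in> borel_measurable M"
    and joint: "\<And>y U. U \<in> interval_unions \<Longrightarrow>
      (\<lambda>n. \<P>(\<omega> in Mn n. Yn n \<omega> \<le> y \<and> emeasure (Nn n \<omega>) U = 0))
        \<longlonglongrightarrow> \<P>(\<omega> in M. Y \<omega> \<le> y) * \<P>(\<omega> in M. emeasure (N \<omega>) U = 0)"
    and U: "U \<in> interval_unions"
  shows "(\<lambda>n. \<P>(\<omega> in Mn n. emeasure (Nn n \<omega>) U = 0)) \<longlonglongrightarrow> \<P>(\<omega> in M. emeasure (N \<omega>) U = 0)"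
proof (rule tendstoI)
  interpret M: prob_space M using pp by (rule point_process_prob_space)
  interpret Mn: prob_space "Mn n" for n using pp_n by (rule point_process_prob_space)
  note [measurable] = Yn Y measurable_point_count[OF pp] measurable_point_count[OF pp_n]
    interval_unions_borel[OF U]
  define q where "q = \<P>(\<omega> in M. emeasure (N \<omega>) U = 0)"
  define qn where "qn n = \<P>(\<omega> in Mn n. emeasure (Nn n \<omega>) U = 0)" for n
  fix e :: real assume e: "0 < e"
  have "(\<lambda>m. \<P>(\<omega> in M. real m < Y \<omega>)) \<longlonglongrightarrow> 0"
  proof (rule prob_tendsto_0_if_AE_eventually_not)
    show "AE \<omega> in M. eventually (\<lambda>m. \<not> real m < Y \<omega>) sequentially"
    proof (rule AE_I2)
      fix \<omega>
      obtain k where "Y \<omega> \<le> real k" using real_arch_simple by blast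
      then show "eventually (\<lambda>m. \<not> real m < Y \<omega>) sequentially"
        by (intro eventually_sequentiallyI[of k]) (simp add: not_less)
    qed
  qed (rule M.prob_space_axioms, measurable)
  then have "eventually (\<lambda>m. \<P>(\<omega> in M. real m < Y \<omega>) < e / 3) sequentially"
    using e by (intro order_tendstoD) auto
  then obtain m where m: "\<P>(\<omega> in M. real m < Y \<omega>) < e / 3" by (auto simp: eventually_sequentially)
  define p where "p = \<P>(\<omega> in M. Y \<omega> \<le> real m)"
  define pn where "pn n = \<P>(\<omega> in Mn n. Yn n \<omega> \<le> real m)" for n
  have "\<P>(\<omega> in M. \<not> Y \<omega> \<le> real m) = 1 - p" unfolding p_def by (rule M.prob_neg) measurable
  with m have p: "1 - p < e / 3" by (simp add: not_le)
  have "pn \<longlonglongrightarrow> p"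
    using joint[OF empty_in_interval_unions, of "real m"] by (simp add: p_def pn_def[abs_def] M.prob_space)
  then have "eventually (\<lambda>n. 1 - e / 3 < pn n) sequentially"
    using p by (intro order_tendstoD) auto
  moreover have "eventually (\<lambda>n. dist (\<P>(\<omega> in Mn n. Yn n \<omega> \<le> real m \<and> emeasure (Nn n \<omega>) U = 0)) (p * q) < e / 3) sequentially"
    unfolding p_def q_def by (rule tendstoD[OF joint[OF U]]) (use e in simp)
  ultimately show "eventually (\<lambda>n. dist (\<P>(\<omega> in Mn n. emeasure (Nn n \<omega>) U = 0)) (\<P>(\<omega> in M. emeasure (N \<omega>) U = 0)) < e) sequentially"
  proof eventually_elim
    case (elim n)
    have "\<P>(\<omega> in Mn n. \<not> Yn n \<omega> \<le> real m) = 1 - pn n" unfolding pn_def by (rule Mn.prob_neg) measurable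
    moreover have "\<bar>\<P>(\<omega> in Mn n. Yn n \<omega> \<le> real m \<and> emeasure (Nn n \<omega>) U = 0) - qn n\<bar>
        \<le> \<P>(\<omega> in Mn n. \<not> Yn n \<omega> \<le> real m)"
      unfolding qn_def
    proof (rule Mn.prob_diff_le_prob_differ)
      show "Measurable.pred (Mn n) (\<lambda>\<omega>. Yn n \<omega> \<le> real m \<and> emeasure (Nn n \<omega>) U = 0)"
          "Measurable.pred (Mn n) (\<lambda>\<omega>. emeasure (Nn n \<omega>) U = 0)"
          "Measurable.pred (Mn n) (\<lambda>\<omega>. \<not> Yn n \<omega> \<le> real m)"
        by measurable
    qed blast
    moreover have "\<bar>p * q - q\<bar> \<le> 1 - p"
    proof -
      have "0 \<le> q" "q \<le> 1" "p \<le> 1" by (auto simp: p_def q_def)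
      then have "(1 - p) * q \<le> (1 - p) * 1" "0 \<le> (1 - p) * q" by (auto intro!: mult_left_mono[of q 1 "1 - p", simplified])
      then show ?thesis by (simp add: algebra_simps)
    qed
    ultimately show ?case
      using elim p unfolding dist_real_def q_def[symmetric] qn_def[symmetric] by linarith
  qed
qed

theorem theorem2p9:
  fixes Mn :: "nat \<Rightarrow> 'a measure" and M :: "'b measure"
    and Yn :: "nat \<Rightarrow> 'a \<Rightarrow> real" and Y :: "'b \<Rightarrow> real"
    and Nn :: "nat \<Rightarrow> 'a \<Rightarrow> real measure" and N :: "'b \<Rightarrow> real measure"
  assumes "\<And>n. prob_space (Mn n)" and "prob_space M"
    and "\<And>n. Yn n \<in> borel_measurable (Mn n)" and "Y \<in> borel_measurable M"
    and Y_conv: "weak_conv_m (\<lambda>n. distr (Mn n) borel (Yn n)) (distr M borel Y)"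
    and "\<And>n. point_process (Mn n) (Nn n)"
    and "simple_point_process M N"
    and "locally_finite_intensity M N"
    and "independent_of_pp M Y N"
    and K1: "\<And>I. is_interval I \<Longrightarrow>
               limsup (\<lambda>n. intensity (Mn n) (Nn n) I) \<le> intensity M N I"
    and K2: "\<And>y U. U \<in> interval_unions \<Longrightarrow>
               (\<lambda>n. \<P>(\<omega> in Mn n. Yn n \<omega> \<le> y \<and> emeasure (Nn n \<omega>) U = 0))
                 \<longlonglongrightarrow> \<P>(\<omega> in M. Y \<omega> \<le> y) * \<P>(\<omega> in M. emeasure (N \<omega>) U = 0)"
  shows "pp_converges_in_distribution Mn Nn M N \<and>
         asymptotically_independent Mn Yn Nn M Y N"
proof -
  have pp: "point_process M N"
    using assms(7) by (simp add: simple_point_process_def)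
  interpret avoidance_and_intensity_convergence Mn Nn M N
  proof
    show "(\<lambda>n. \<P>(\<omega> in Mn n. emeasure (Nn n \<omega>) U = 0)) \<longlonglongrightarrow> \<P>(\<omega> in M. emeasure (N \<omega>) U = 0)"
      if "U \<in> interval_unions" for U
      by (rule avoidance_without_marks[OF assms(6) pp assms(3,4) K2 that])
  qed (fact assms)+
  have "asymptotically_independent Mn Yn Nn M Y N"
    unfolding asymptotically_independent_def
  proof (intro allI impI)
    fix y and k :: nat and B :: "nat \<Rightarrow> real set" and l :: "nat \<Rightarrow> nat"
    assume B: "\<forall>i\<in>{1..k}. B i \<in> continuity_sets M N"
    note [measurable] = assms(3)
    have "(\<lambda>n. \<P>(\<omega> in Mn n. Yn n \<omega> \<le> y \<and> (\<forall>i\<in>{1..k}. emeasure (Nn n \<omega>) (B i) \<in> {..of_nat (l i)})))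
        \<longlonglongrightarrow> \<P>(\<omega> in M. Y \<omega> \<le> y) * \<P>(\<omega> in M. \<forall>i\<in>{1..k}. emeasure (N \<omega>) (B i) \<in> {..of_nat (l i)})"
    proof (rule count_convergence)
      show "(\<lambda>m. \<P>(\<omega> in M. emeasure (N \<omega>) (straddling m R (B i)) \<noteq> 0)) \<longlonglongrightarrow> 0"
        if "i \<in> {1..k}" for i R
        using B that by (intro continuity_set_straddling_tendsto_0 pp) blast
    qed (use B K2 in \<open>auto simp: continuity_sets_def\<close>)
    then show "(\<lambda>n. \<P>(\<omega> in Mn n. Yn n \<omega> \<le> y \<and> (\<forall>i\<in>{1..k}. emeasure (Nn n \<omega>) (B i) \<le> of_nat (l i))))
        \<longlonglongrightarrow> \<P>(\<omega> in M. Y \<omega> \<le> y) * \<P>(\<omega> in M. \<forall>i\<in>{1..k}. emeasure (N \<omega>) (B i) \<le> of_nat (l i))"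
      by simp
  qed
  with vague_convergence show ?thesis by blast
qed

end
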